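(* Let $U=\prod_l U_l$ be an $n$-qubit quantum circuit (the gate $U_1$ applied first, then $U_2$, and so on), where $U_l=\exp(-iH_lT_l)$ with runtime $T_l\ge0$ and $H_l$ a time-independent Hamiltonian acting nontrivially only on $k_l$ qubits. Then $\mathcal R(U)\ge \frac12 C_{W_1}(U)$.
   Context: For $\mathcal H=(\mathbb C^2)^{\otimes n}$, let $O(\mathcal H)$ be the traceless Hermitian operators and $D(\mathcal H)$ the density operators. For $A\in O(\mathcal H)$, $\|A\|_{W_1}:=\frac12\min\left\{\sum_{i=1}^n\|X_i\|_1 : A=\sum_i X_i,\ X_i\in O(\mathcal H),\ \mathrm{Tr}_i X_i=0\ \forall i\right\}$, with $\mathrm{Tr}_i$ the partial trace over the $i$-th qubit and $\|\cdot\|_1$ the trace norm. $C_{W_1}(U):=\max_{\rho\in D(\mathcal H)}\|\rho-U\rho U^\dagger\|_{W_1}$. Writing the eigenvalues of $H_l$ restricted to its $k_l$-qubit support as $h_1\le\dots\le h_{2^{k_l}}$, set $E_l:=(h_{2^{k_l}}-h_1)/2$. The experimental cost is $\mathcal R(U):=\sum_l k_lE_lT_l$. *)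

theory Defs
  imports "HOL-Analysis.Analysis" "HOL-Library.Multiset" "Jordan_Normal_Form.Matrix"
    "Jordan_Normal_Form.Char_Poly" "Jordan_Normal_Form.Schur_Decomposition"
begin

(* Conventions: an n-qubit operator is a (2^n) x (2^n) complex matrix; computational
   basis index a < 2^n, qubit i (0 <= i < n) corresponds to bit i of a. *)

definition qbit :: "nat \<Rightarrow> nat \<Rightarrow> nat" where
  "qbit a i = (a div 2 ^ i) mod 2"

definition mtrace :: "complex mat \<Rightarrow> complex" where
  "mtrace A = (\<Sum>i<dim_row A. A $$ (i, i))"

definition hermitian :: "complex mat \<Rightarrow> bool" where
  "hermitian A \<longleftrightarrow> mat_adjoint A = A"

definition obs0 :: "nat \<Rightarrow> complex mat \<Rightarrow> bool" where
  "obs0 n A \<longleftrightarrow> A \<in> carrier_mat (2^n) (2^n) \<and> hermitian A \<and> mtrace A = 0"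

definition psd :: "complex mat \<Rightarrow> bool" where
  "psd A \<longleftrightarrow> (\<forall>v \<in> carrier_vec (dim_col A).
      (A *\<^sub>v v) \<bullet>c v \<in> \<real> \<and> 0 \<le> Re ((A *\<^sub>v v) \<bullet>c v))"

definition density :: "nat \<Rightarrow> complex mat \<Rightarrow> bool" where
  "density n \<rho> \<longleftrightarrow> \<rho> \<in> carrier_mat (2^n) (2^n) \<and> hermitian \<rho> \<and> psd \<rho> \<and> mtrace \<rho> = 1"

definition ins_bit :: "nat \<Rightarrow> nat \<Rightarrow> nat \<Rightarrow> nat" where
  "ins_bit i c a = a mod 2 ^ i + c * 2 ^ i + (a div 2 ^ i) * 2 ^ (Suc i)"

definition ptrace :: "nat \<Rightarrow> nat \<Rightarrow> complex mat \<Rightarrow> complex mat" where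
  "ptrace n i X = mat (2 ^ (n - 1)) (2 ^ (n - 1))
     (\<lambda>(a, b). \<Sum>c\<in>{0, 1}. X $$ (ins_bit i c a, ins_bit i c b))"

definition eigvals :: "complex mat \<Rightarrow> complex multiset" where
  "eigvals A = (THE M. char_poly A = (\<Prod>a\<in>#M. [:- a, 1:]))"

(* trace norm = sum of singular values = sum of square roots of eigenvalues of A^dagger A *)
definition trace_norm :: "complex mat \<Rightarrow> real" where
  "trace_norm A = (\<Sum>\<mu>\<in>#eigvals (mat_adjoint A * A). sqrt (Re \<mu>))"

definition msum :: "nat \<Rightarrow> nat \<Rightarrow> (nat \<Rightarrow> complex mat) \<Rightarrow> complex mat" where
  "msum d n X = mat d d (\<lambda>ab. \<Sum>i<n. X i $$ ab)"

definition W1_norm :: "nat \<Rightarrow> complex mat \<Rightarrow> real" where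
  "W1_norm n A = Inf {(1/2) * (\<Sum>i<n. trace_norm (X i)) | X.
      (\<forall>i<n. obs0 n (X i) \<and> ptrace n i (X i) = 0\<^sub>m (2^(n-1)) (2^(n-1)))
      \<and> A = msum (2^n) n X}"

definition C_W1 :: "nat \<Rightarrow> complex mat \<Rightarrow> real" where
  "C_W1 n U = Sup {W1_norm n (\<rho> - U * \<rho> * mat_adjoint U) | \<rho>. density n \<rho>}"

definition mat_exp :: "complex mat \<Rightarrow> complex mat" where
  "mat_exp A = mat (dim_row A) (dim_col A)
     (\<lambda>ij. lim (\<lambda>N. \<Sum>k<N. (A ^\<^sub>m k) $$ ij / of_nat (fact k)))"

definition sub_index :: "nat set \<Rightarrow> nat \<Rightarrow> nat" where
  "sub_index S a = (\<Sum>m<card S. qbit a (sorted_list_of_set S ! m) * 2 ^ m)"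

(* h \<otimes> identity: operator h on the qubits S, identity on the other qubits of n *)
definition embed :: "nat \<Rightarrow> nat set \<Rightarrow> complex mat \<Rightarrow> complex mat" where
  "embed n S h = mat (2 ^ n) (2 ^ n) (\<lambda>(a, b).
     if (\<forall>j<n. j \<notin> S \<longrightarrow> qbit a j = qbit b j) then h $$ (sub_index S a, sub_index S b) else 0)"

definition spread :: "complex mat \<Rightarrow> real" where
  "spread h = (Max (Re ` {x. eigenvalue h x}) - Min (Re ` {x. eigenvalue h x})) / 2"

(* circuit U = U_L ... U_2 U_1 (U_0 applied first in 0-based indexing) *)
definition circuit :: "nat \<Rightarrow> (nat \<Rightarrow> complex mat) \<Rightarrow> nat \<Rightarrow> complex mat" where
  "circuit n G L = foldl (\<lambda>acc l. G l * acc) (1\<^sub>m (2 ^ n)) [0..<L]"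

end

theory Submission
  imports Defs
begin

text \<open>
  Put $\rho_0 = \rho$ and $\rho_{l+1} = U_l \rho_l U_l^\dagger$, and write the difference
  $\rho - U\rho U^\dagger$ as the sum of the differences $D_l = \rho_l - U_l \rho_l U_l^\dagger$.
  Up to a global phase $U_l$ has eigenvalues $e^{i\theta}$ with $|\theta| \le E_l T_l$, which gives
  $\|D_l\|_1 \le 2 E_l T_l$. Moreover, $D_l$ has vanishing partial trace over the $k_l$ qubits in the
  support of $U_l$, hence completely depolarising these qubits one after the other takes $D_l$ to $0$.
  The increment of each depolarising step has vanishing partial trace over the depolarised qubit and
  trace norm at most $2 \|D_l\|_1$, since depolarising is an average of unitary conjugations.
  Telescoping, $\|D_l\|_{W_1} \le k_l \|D_l\|_1 \le 2 k_l E_l T_l$.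
\<close>

text \<open>\<open>trace_norm\<close> rests on a description of an eigenvalue multiset, which gives
  no direct access to norm inequalities. For Hermitian X the spectral theorem evaluates it, and the
  value is recast as the maximum of |tr(V X)| over unitaries V. Linearity and cyclicity of the trace
  then yield the triangle inequality, the behaviour under conjugation and the bound on D_l. The same
  pairing replaces a partial trace over several qubits. To see that the depolarised D_l vanishes,
  pair it with an arbitrary M and move the channels over to M: the outcome acts trivially on the
  support, hence commutes with U_l, and the two halves of D_l have equal trace against it. Two
  factors 2 occur. One comes from the two terms of a depolarising increment and is absorbed by the
  1/2 in the Wasserstein norm. The other comes from multiplying by the gate on the left and by its
  adjoint on the right; it accounts for the 1/2 in the theorem. A state enters the gate bound only
  as a Hermitian matrix with its trace norm, so positivity is used once, for the initial
  state.\<close>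

lemma index_mult_mat_sum:
  assumes "A \<in> carrier_mat n k" "B \<in> carrier_mat k m" "i < n" "j < m"
  shows "(A * B) $$ (i, j) = (\<Sum>l<k. A $$ (i, l) * B $$ (l, j))"
  using assms by (auto simp: scalar_prod_def lessThan_atLeast0 intro!: sum.cong)

section \<open>Adjoints, Hermitian matrices and unitary matrices\<close>

lemma mat_adjoint_dim [simp]:
  "dim_row (mat_adjoint A) = dim_col A" "dim_col (mat_adjoint A) = dim_row A"
  by (auto simp: mat_adjoint_def)

lemma mat_adjoint_carrier [simp]:
  "A \<in> carrier_mat n m \<Longrightarrow> mat_adjoint A \<in> carrier_mat m n"
  by auto

lemma mat_adjoint_index [simp]:
  fixes A :: "complex mat"
  assumes "i < dim_col A" "j < dim_row A"
  shows "mat_adjoint A $$ (i, j) = cnj (A $$ (j, i))"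
  using assms by (auto simp: mat_adjoint_def mat_of_rows_def)

lemma mat_adjoint_adjoint [simp]: "mat_adjoint (mat_adjoint A) = (A :: complex mat)"
  by (rule eq_matI) auto

lemma mat_adjoint_mult:
  fixes A B :: "complex mat"
  assumes "A \<in> carrier_mat n k" "B \<in> carrier_mat k m"
  shows "mat_adjoint (A * B) = mat_adjoint B * mat_adjoint A"
  using assms
  by (intro eq_matI)
    (auto simp: index_mult_mat_sum[of _ m k _ n] index_mult_mat_sum[of _ n k _ m] mult.commute
      simp del: index_mult_mat(1))

lemma carrier_dims: "A \<in> carrier_mat n m \<Longrightarrow> dim_row A = n \<and> dim_col A = m"
  by auto

text \<open>Dimension equations replace carrier premises: as a rewrite rule this leaves no
  intermediate dimension to guess, so \<open>simp\<close> can reassociate long products.\<close>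

lemma mult_assoc_dim:
  "dim_col A = dim_row B \<Longrightarrow> dim_col B = dim_row C \<Longrightarrow> A * B * C = A * (B * C :: complex mat)"
  by (rule assoc_mult_mat) auto

lemma mat_adjoint_mult_dim:
  "dim_col A = dim_row B \<Longrightarrow> mat_adjoint (A * B) = mat_adjoint B * mat_adjoint (A :: complex mat)"
  by (rule mat_adjoint_mult) auto

lemma mat_adjoint_one [simp]: "mat_adjoint (1\<^sub>m n :: complex mat) = 1\<^sub>m n"
  by (rule eq_matI) auto

lemma dim_mat_diag [simp]: "dim_row (mat_diag n f) = n" "dim_col (mat_diag n f) = n"
  by (auto simp: mat_diag_def)

lemma mat_adjoint_mat_diag: "mat_adjoint (mat_diag n f) = mat_diag n (\<lambda>i. cnj (f i))"
  by (rule eq_matI) (auto simp: mat_diag_def)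

lemma mat_adjoint_add:
  fixes A B :: "complex mat"
  assumes "A \<in> carrier_mat n m" "B \<in> carrier_mat n m"
  shows "mat_adjoint (A + B) = mat_adjoint A + mat_adjoint B"
  using assms by (intro eq_matI) auto

lemma mat_adjoint_minus:
  fixes A B :: "complex mat"
  assumes "A \<in> carrier_mat n m" "B \<in> carrier_mat n m"
  shows "mat_adjoint (A - B) = mat_adjoint A - mat_adjoint B"
  using assms by (intro eq_matI) auto

lemma hermitian_index:
  assumes "hermitian A" "A \<in> carrier_mat n n" "i < n" "j < n"
  shows "A $$ (j, i) = cnj (A $$ (i, j))"
proof -
  have "mat_adjoint A $$ (j, i) = cnj (A $$ (i, j))"
    using assms by (intro mat_adjoint_index) auto
  then show ?thesis
    using assms(1) by (simp add: hermitian_def)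
qed

lemma hermitianI:
  assumes "A \<in> carrier_mat n n" "\<And>i j. i < n \<Longrightarrow> j < n \<Longrightarrow> A $$ (j, i) = cnj (A $$ (i, j))"
  shows "hermitian A"
  unfolding hermitian_def
proof (rule eq_matI)
  fix i j assume "i < dim_row A" "j < dim_col A"
  then have "i < n" "j < n"
    using assms(1) by auto
  then show "mat_adjoint A $$ (i, j) = A $$ (i, j)"
    using assms(1) assms(2)[of j i] by simp
qed (use assms(1) in auto)

text \<open>One product suffices, because a left inverse of a square matrix is also a right inverse;
  \<open>unitaryD\<close> recovers the other product.\<close>

definition unitary :: "nat \<Rightarrow> complex mat \<Rightarrow> bool" where
  "unitary n P \<longleftrightarrow> P \<in> carrier_mat n n \<and> mat_adjoint P * P = 1\<^sub>m n"

lemma unitaryD: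
  assumes "unitary n P"
  shows "P \<in> carrier_mat n n" "mat_adjoint P * P = 1\<^sub>m n" "P * mat_adjoint P = 1\<^sub>m n"
proof -
  show P: "P \<in> carrier_mat n n" "mat_adjoint P * P = 1\<^sub>m n"
    using assms by (auto simp: unitary_def)
  show "P * mat_adjoint P = 1\<^sub>m n"
    using mat_mult_left_right_inverse[OF mat_adjoint_carrier[OF P(1)] P] .
qed

lemma unitary_adjoint: "unitary n P \<Longrightarrow> unitary n (mat_adjoint P)"
  unfolding unitary_def[of _ "mat_adjoint P"] by (simp add: unitaryD)

lemma unitary_one: "unitary n (1\<^sub>m n)"
  by (auto simp: unitary_def)

lemma mult_adjoint_cancel:
  assumes "unitary n P" "A \<in> carrier_mat n m"
  shows "mat_adjoint P * (P * A) = A" "P * (mat_adjoint P * A) = A"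
  using unitaryD[OF assms(1)] assms(2)
    assoc_mult_mat[of "mat_adjoint P" n n P n A m] assoc_mult_mat[of P n n "mat_adjoint P" n A m]
  by auto

lemma unitary_mult:
  assumes P: "unitary n P" and Q: "unitary n Q"
  shows "unitary n (P * Q)"
proof -
  note c = unitaryD(1)[OF P] unitaryD(1)[OF Q]
  have "mat_adjoint (P * Q) * (P * Q) = mat_adjoint Q * (mat_adjoint P * (P * Q))"
    using c[THEN carrier_dims] by (simp add: mat_adjoint_mult_dim mult_assoc_dim)
  also have "\<dots> = 1\<^sub>m n"
    using mult_adjoint_cancel[OF P c(2)] unitaryD(2)[OF Q] by simp
  finally show ?thesis
    using c by (auto simp: unitary_def)
qed

lemma unitary_mat_diag:
  assumes "\<And>i. i < n \<Longrightarrow> cmod (d i) = 1"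
  shows "unitary n (mat_diag n d)"
proof -
  have "cnj (d i) * d i = 1" if "i < n" for i
    using assms[OF that] by (metis complex_norm_square mult.commute of_real_1 one_power2)
  then show ?thesis
    unfolding unitary_def mat_adjoint_mat_diag mat_diag_diag
    by (auto intro!: eq_matI simp: mat_diag_def)
qed

subsection \<open>The spectral theorem\<close>

lemma adjoint_four_block_mat:
  fixes A B C D :: "complex mat"
  assumes "A \<in> carrier_mat a a" "B \<in> carrier_mat a b" "C \<in> carrier_mat b a" "D \<in> carrier_mat b b"
  shows "mat_adjoint (four_block_mat A B C D)
    = four_block_mat (mat_adjoint A) (mat_adjoint C) (mat_adjoint B) (mat_adjoint D)"
  using assms by (intro eq_matI) auto

lemma mult_block_diag:
  fixes A D :: "complex mat"
  assumes "A \<in> carrier_mat a a" "A' \<in> carrier_mat a a" "D \<in> carrier_mat b b" "D' \<in> carrier_mat b b"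
  shows "four_block_mat A (0\<^sub>m a b) (0\<^sub>m b a) D * four_block_mat A' (0\<^sub>m a b) (0\<^sub>m b a) D'
    = four_block_mat (A * A') (0\<^sub>m a b) (0\<^sub>m b a) (D * D')"
proof -
  have "A * A' \<in> carrier_mat a a" "D * D' \<in> carrier_mat b b"
    using assms by auto
  then show ?thesis
    using assms by (subst mult_four_block_mat[of _ a a _ b _ b _ _ a _ b]) auto
qed

text \<open>An eigenvector exists because the characteristic polynomial splits over the complex
  numbers. Completing it to a basis and orthogonalising keeps it in first place, and normalised
  columns make the matrix unitary.\<close>

lemma unitary_with_eigenvector_column:
  fixes A :: "complex mat"
  assumes A: "A \<in> carrier_mat n n" and n: "n \<noteq> 0"
  obtains e W where "unitary n W" "\<And>i. i < n \<Longrightarrow> (A * W) $$ (i, 0) = e * W $$ (i, 0)"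
proof -
  obtain as where as: "char_poly A = (\<Prod>a\<leftarrow>as. [:- a, 1:])" "length as = n"
    using char_poly_factorized[OF A] by auto
  then obtain e where "e \<in> set as"
    using n by (cases as) auto
  then have "poly (char_poly A) e = 0"
    by (auto simp: as(1) poly_prod_list prod_list_zero_iff)
  then have "eigenvalue A e"
    using eigenvalue_root_char_poly[OF A] by auto
  then obtain v where v: "v \<in> carrier_vec n" "v \<noteq> 0\<^sub>v n" "A *\<^sub>v v = e \<cdot>\<^sub>v v"
    using A by (auto simp: eigenvalue_def eigenvector_def)
  define ws where "ws = gram_schmidt n (basis_completion v)"
  interpret cof_vec_space n "TYPE(complex)" .
  note b = basis_completion[OF v(1,2)]
  obtain vs where bv: "basis_completion v = v # vs"
    using b(6,7) n by (cases "basis_completion v") auto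
  have ws: "set ws \<subseteq> carrier_vec n" "corthogonal ws" "length ws = n"
    using gram_schmidt_result[OF b(2,4,5) refl] b(6) by (auto simp: ws_def)
  have "hd ws = v"
    using gram_schmidt_hd[OF v(1), of vs] by (simp add: ws_def bv)
  then have ws0: "ws ! 0 = v"
    using ws(3) n by (cases ws) auto
  have wsc: "ws ! i \<in> carrier_vec n" if "i < n" for i
    using ws that by auto
  \<comment> \<open>\<open>gram_schmidt\<close> delivers orthogonal vectors without normalising
    them; \<open>r i\<close> is the length to divide by.\<close>
  define r where "r i = sqrt (\<Sum>k<n. (cmod (ws ! i $ k))\<^sup>2)" for i
  have ip: "(\<Sum>k<n. ws ! i $ k * cnj (ws ! j $ k)) = ws ! i \<bullet>c ws ! j" if "i < n" "j < n" for i j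
    using wsc[OF that(1)] wsc[OF that(2)]
    by (auto simp: scalar_prod_def lessThan_atLeast0 intro!: sum.cong)
  have r2: "(\<Sum>k<n. ws ! i $ k * cnj (ws ! i $ k)) = (complex_of_real (r i))\<^sup>2" for i
  proof -
    have "(r i)\<^sup>2 = (\<Sum>k<n. (cmod (ws ! i $ k))\<^sup>2)"
      unfolding r_def by (intro real_sqrt_pow2 sum_nonneg) auto
    then show ?thesis
      by (simp only: complex_norm_square[symmetric] of_real_sum[symmetric] of_real_power[symmetric])
  qed
  have r0: "r i \<noteq> 0" if "i < n" for i
    using corthogonalD[OF ws(2), of i i] ip[OF that that] r2[of i] that ws(3) by auto
  define W where "W = mat n n (\<lambda>(i, j). ws ! j $ i / complex_of_real (r j))"
  have W: "W \<in> carrier_mat n n"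
    by (simp add: W_def)
  have "mat_adjoint W * W = 1\<^sub>m n"
  proof (rule eq_matI)
    fix i j assume "i < dim_row (1\<^sub>m n)" "j < dim_col (1\<^sub>m n)"
    then have ij: "i < n" "j < n" by auto
    have "(mat_adjoint W * W) $$ (i, j)
        = (\<Sum>k<n. ws ! j $ k * cnj (ws ! i $ k)) / (complex_of_real (r i) * complex_of_real (r j))"
      using ij by (simp add: index_mult_mat_sum[of _ n n _ n] W W_def sum_divide_distrib mult.commute
          del: index_mult_mat(1))
    also have "\<dots> = (1\<^sub>m n) $$ (i, j)"
    proof (cases "i = j")
      case True
      then show ?thesis
        unfolding True r2 using r0[OF ij(2)] ij by (simp add: power2_eq_square)
    next
      case False
      then have "ws ! j \<bullet>c ws ! i = 0"
        using corthogonalD[OF ws(2), of j i] ij ws(3) by auto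
      then show ?thesis
        using False ij by (simp add: ip)
    qed
    finally show "(mat_adjoint W * W) $$ (i, j) = (1\<^sub>m n) $$ (i, j)" .
  qed (use W in auto)
  then have "unitary n W"
    using W by (simp add: unitary_def)
  moreover have "(A * W) $$ (i, 0) = e * W $$ (i, 0)" if i: "i < n" for i
  proof -
    have "(\<Sum>k<n. A $$ (i, k) * v $ k) = (A *\<^sub>v v) $ i"
      using A v(1) i by (auto simp: scalar_prod_def lessThan_atLeast0 intro!: sum.cong)
    also have "\<dots> = e * v $ i"
      unfolding v(3) using v(1) i by auto
    finally show ?thesis
      using n i ws0
      by (simp add: index_mult_mat_sum[OF A W], simp add: W_def sum_divide_distrib[symmetric])
  qed
  ultimately show ?thesis
    using that by blast
qed

lemma hermitian_conj:
  assumes A: "A \<in> carrier_mat n n" "hermitian A" and W: "W \<in> carrier_mat n n"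
  shows "hermitian (W * A * mat_adjoint W)"
  unfolding hermitian_def using A(2) A(1)[THEN carrier_dims] W[THEN carrier_dims]
  by (simp add: hermitian_def mat_adjoint_mult_dim mult_assoc_dim)

lemma unitary_conj_conj:
  assumes W: "unitary n W" and A: "A \<in> carrier_mat n n"
  shows "W * (mat_adjoint W * A * W) * mat_adjoint W = A"
proof -
  note c = unitaryD(1)[OF W] A
  have "W * (mat_adjoint W * A * W) * mat_adjoint W = W * (mat_adjoint W * (A * (W * mat_adjoint W)))"
    using c[THEN carrier_dims] by (simp add: mult_assoc_dim)
  then show ?thesis
    using c unitaryD(3)[OF W] mult_adjoint_cancel[OF W] by simp
qed

text \<open>Deflation: conjugating by a unitary whose first column is an eigenvector clears the rest
  of the first column, hermiticity then clears the first row, and the remaining block is Hermitian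
  and smaller by one.\<close>

theorem hermitian_spectral:
  assumes "A \<in> carrier_mat n n" "hermitian A"
  obtains P d where "unitary n P"
    "A = P * mat_diag n (\<lambda>i. complex_of_real (d i)) * mat_adjoint P"
proof -
  have "\<exists>P d. unitary n P \<and> A = P * mat_diag n (\<lambda>i. complex_of_real (d i)) * mat_adjoint P"
    using assms
  proof (induction n arbitrary: A)
    case 0
    then show ?case
      by (intro exI[of _ "1\<^sub>m 0"]) (auto simp: unitary_def intro!: eq_matI)
  next
    case (Suc m)
    obtain e W where W: "unitary (Suc m) W"
      and e: "\<And>i. i < Suc m \<Longrightarrow> (A * W) $$ (i, 0) = e * W $$ (i, 0)"
      using unitary_with_eigenvector_column[OF Suc.prems(1)] by (metis nat.distinct(1))
    note Wc = unitaryD(1)[OF W]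
    define B where "B = mat_adjoint W * A * W"
    have Bc: "B \<in> carrier_mat (Suc m) (Suc m)"
      using Wc Suc.prems by (auto simp: B_def)
    have Bh: "hermitian B"
      using hermitian_conj[OF Suc.prems, of "mat_adjoint W"] Wc by (simp add: B_def)
    have B0: "B $$ (i, 0) = (if i = 0 then e else 0)" if i: "i < Suc m" for i
    proof -
      have "B $$ (i, 0) = (mat_adjoint W * (A * W)) $$ (i, 0)"
        using Wc[THEN carrier_dims] Suc.prems(1)[THEN carrier_dims] by (simp add: B_def mult_assoc_dim)
      also have "\<dots> = e * (mat_adjoint W * W) $$ (i, 0)"
        using i Wc Suc.prems e
        by (simp add: index_mult_mat_sum[of "mat_adjoint W" "Suc m" "Suc m" _ "Suc m"]
            sum_distrib_left mult_ac del: index_mult_mat(1) sum.lessThan_Suc)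
      finally show ?thesis
        using i by (simp add: unitaryD(2)[OF W])
    qed
    \<comment> \<open>The eigenvalue has become a diagonal entry of a Hermitian matrix.\<close>
    have e_real: "e = complex_of_real (Re e)"
      using hermitian_index[OF Bh Bc, of 0 0] B0[of 0] by (simp add: complex_eq_iff)
    define C where "C = mat m m (\<lambda>(i, j). B $$ (Suc i, Suc j))"
    have Cc: "C \<in> carrier_mat m m"
      by (simp add: C_def)
    have "hermitian C"
      by (rule hermitianI[OF Cc]) (auto simp: C_def hermitian_index[OF Bh Bc, symmetric])
    from Suc.IH[OF Cc this] obtain P d where P: "unitary m P"
      and C: "C = P * mat_diag m (\<lambda>i. complex_of_real (d i)) * mat_adjoint P"
      by blast
    note Pc = unitaryD(1)[OF P]
    define d' where "d' i = (case i of 0 \<Rightarrow> Re e | Suc j \<Rightarrow> d j)" for i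
    define P' where "P' = four_block_mat (1\<^sub>m 1) (0\<^sub>m 1 m) (0\<^sub>m m 1) P"
    have P'c: "P' \<in> carrier_mat (Suc m) (Suc m)"
      using Pc by (auto simp: P'_def)
    have z: "mat_adjoint (0\<^sub>m a b :: complex mat) = 0\<^sub>m b a" for a b
      by (rule eq_matI) auto
    have P'a: "mat_adjoint P' = four_block_mat (1\<^sub>m 1) (0\<^sub>m 1 m) (0\<^sub>m m 1) (mat_adjoint P)"
      using Pc by (simp add: P'_def adjoint_four_block_mat[of _ 1 _ m] z)
    have "mat_adjoint P' * P' = four_block_mat (1\<^sub>m 1) (0\<^sub>m 1 m) (0\<^sub>m m 1) (1\<^sub>m m)"
      unfolding P'a unfolding P'_def
      using Pc unitaryD(2)[OF P] by (subst mult_block_diag) auto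
    also have "\<dots> = 1\<^sub>m (Suc m)"
      by (rule eq_matI) auto
    finally have P'u: "unitary (Suc m) P'"
      using P'c by (simp add: unitary_def)
    have D: "mat_diag (Suc m) (\<lambda>i. complex_of_real (d' i))
        = four_block_mat (mat 1 1 (\<lambda>_. e)) (0\<^sub>m 1 m) (0\<^sub>m m 1) (mat_diag m (\<lambda>i. complex_of_real (d i)))"
      using e_real by (intro eq_matI) (auto simp: mat_diag_def d'_def split: nat.splits)
    have "P' * mat_diag (Suc m) (\<lambda>i. complex_of_real (d' i)) * mat_adjoint P'
       = four_block_mat (mat 1 1 (\<lambda>_. e)) (0\<^sub>m 1 m) (0\<^sub>m m 1) C"
      unfolding P'a D C unfolding P'_def using Pc
      by (simp add: mult_block_diag mult_carrier_mat[of _ m m])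
    also have "\<dots> = B"
    proof (rule eq_matI)
      fix i j assume "i < dim_row B" "j < dim_col B"
      then have ij: "i < Suc m" "j < Suc m"
        using Bc by auto
      have "B $$ (0, j) = cnj (B $$ (j, 0))"
        using hermitian_index[OF Bh Bc ij(2), of 0] by simp
      then have "B $$ (0, j) = (if j = 0 then e else 0)"
        using B0[OF ij(2)] e_real by (auto simp: complex_eq_iff)
      then show "four_block_mat (mat 1 1 (\<lambda>_. e)) (0\<^sub>m 1 m) (0\<^sub>m m 1) C $$ (i, j) = B $$ (i, j)"
        using ij B0[OF ij(1)] Cc by (cases i; cases j) (auto simp: C_def)
    qed (use Bc Cc in auto)
    finally have B: "B = P' * mat_diag (Suc m) (\<lambda>i. complex_of_real (d' i)) * mat_adjoint P'" by simp
    have "A = W * B * mat_adjoint W"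
      unfolding B_def using unitary_conj_conj[OF W Suc.prems(1)] by simp
    also have "\<dots> = (W * P') * mat_diag (Suc m) (\<lambda>i. complex_of_real (d' i)) * mat_adjoint (W * P')"
      unfolding B using Wc[THEN carrier_dims] P'c[THEN carrier_dims]
      by (simp add: mat_adjoint_mult_dim
          mult_assoc_dim)
    finally show ?case
      using unitary_mult[OF W P'u] by blast
  qed
  then show ?thesis
    using that by blast
qed

subsection \<open>The trace norm of Hermitian matrices\<close>

lemma mtrace_mult:
  assumes "A \<in> carrier_mat n m" "B \<in> carrier_mat m n"
  shows "mtrace (A * B) = (\<Sum>i<n. \<Sum>j<m. A $$ (i, j) * B $$ (j, i))"
  using assms unfolding mtrace_def
  by (simp add: index_mult_mat_sum[of _ n m _ n] del: index_mult_mat(1))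

lemma mtrace_mult_comm:
  assumes "A \<in> carrier_mat n m" "B \<in> carrier_mat m n"
  shows "mtrace (A * B) = mtrace (B * A)"
  unfolding mtrace_mult[OF assms] mtrace_mult[OF assms(2,1)]
  by (subst sum.swap) (simp add: mult.commute)

lemma mtrace_add:
  assumes "A \<in> carrier_mat n n" "B \<in> carrier_mat n n"
  shows "mtrace (A + B) = mtrace A + mtrace B"
  using assms by (auto simp: mtrace_def sum.distrib)

lemma mtrace_minus:
  assumes "A \<in> carrier_mat n n" "B \<in> carrier_mat n n"
  shows "mtrace (A - B) = mtrace A - mtrace B"
  using assms by (auto simp: mtrace_def sum_subtractf)

lemma mtrace_unitary_conj:
  assumes "unitary n U" "A \<in> carrier_mat n n"
  shows "mtrace (U * A * mat_adjoint U) = mtrace A"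
proof -
  note c = unitaryD(1)[OF assms(1)] assms(2)
  have "mtrace (U * A * mat_adjoint U) = mtrace (mat_adjoint U * (U * A))"
    using c by (intro mtrace_mult_comm[of _ n n]) auto
  then show ?thesis
    using mult_adjoint_cancel[OF assms(1) c(2)] by simp
qed

lemma char_poly_mat_diag: "char_poly (mat_diag n f) = (\<Prod>a\<leftarrow>map f [0..<n]. [:- a, 1:])"
proof -
  have "diag_mat (mat_diag n f) = map f [0..<n]"
    by (auto simp: diag_mat_def mat_diag_def intro!: nth_equalityI)
  moreover have "upper_triangular (mat_diag n f)"
    by (auto simp: mat_diag_def)
  ultimately show ?thesis
    using char_poly_upper_triangular[OF mat_diag_dim, of n f] by simp
qed

lemma char_poly_unitary_diag:
  assumes "unitary n P"
  shows "char_poly (P * mat_diag n f * mat_adjoint P) = (\<Prod>a\<leftarrow>map f [0..<n]. [:- a, 1:])"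
proof -
  have "similar_mat (P * mat_diag n f * mat_adjoint P) (mat_diag n f)"
    unfolding similar_mat_def
    using unitaryD[OF assms] by (intro exI[of _ P] exI[of _ "mat_adjoint P"] similar_mat_witI[of _ _ n]) auto
  then show ?thesis
    using char_poly_similar char_poly_mat_diag by metis
qed

text \<open>The multiset can be read back from its product of linear factors. This uniqueness is
  what lets the description in \<open>eigvals\<close> denote.\<close>

lemma proots_linear_factors: "proots (\<Prod>a\<in>#M. [:- a, 1:]) = (M :: complex multiset)"
proof (induction M)
  case (add x M)
  have "(\<Prod>a\<in>#M. [:- a, 1:]) \<noteq> 0"
    by (auto simp: prod_mset_zero_iff)
  then show ?case
    using add by (simp add: proots_mult del: mult_pCons_left)
qed auto

lemma eigvals_unitary_diag:
  assumes "unitary n P"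
  shows "eigvals (P * mat_diag n f * mat_adjoint P) = mset (map f [0..<n])"
  unfolding eigvals_def char_poly_unitary_diag[OF assms]
proof (rule the_equality)
  show *: "(\<Prod>a\<leftarrow>map f [0..<n]. [:- a, 1:]) = (\<Prod>a\<in>#mset (map f [0..<n]). [:- a, 1:])"
    by (simp add: prod_mset_prod_list flip: mset_map)
  fix M assume "(\<Prod>a\<leftarrow>map f [0..<n]. [:- a, 1:]) = (\<Prod>a\<in>#M. [:- a, 1:])"
  then show "M = mset (map f [0..<n])"
    using * proots_linear_factors by metis
qed

lemma unitary_diag_mult:
  assumes "unitary n P"
  shows "(P * mat_diag n f * mat_adjoint P) * (P * mat_diag n g * mat_adjoint P)
    = P * mat_diag n (\<lambda>i. f i * g i) * mat_adjoint P"
proof -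
  note c = unitaryD(1)[OF assms, THEN carrier_dims]
  have "(P * mat_diag n f * mat_adjoint P) * (P * mat_diag n g * mat_adjoint P)
      = P * (mat_diag n f * (mat_adjoint P * (P * (mat_diag n g * mat_adjoint P))))"
    using c by (simp add: mult_assoc_dim)
  also have "\<dots> = P * (mat_diag n f * (mat_diag n g * mat_adjoint P))"
    using unitaryD(1)[OF assms] by (subst mult_adjoint_cancel[OF assms, of _ n]) auto
  also have "\<dots> = P * (mat_diag n f * mat_diag n g) * mat_adjoint P"
    using c by (simp add: mult_assoc_dim del: mat_diag_diag)
  finally show ?thesis by simp
qed

lemma unitary_diag_adjoint:
  assumes "unitary n P"
  shows "mat_adjoint (P * mat_diag n f * mat_adjoint P) = P * mat_diag n (\<lambda>i. cnj (f i)) * mat_adjoint P"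
  using unitaryD(1)[OF assms, THEN carrier_dims]
  by (simp add: mat_adjoint_mult_dim mult_assoc_dim mat_adjoint_mat_diag)

text \<open>In the same eigenbasis the product of the adjoint with the matrix has the squares of the
  \<open>d i\<close> as eigenvalues, and their square roots are the absolute values.\<close>

lemma trace_norm_unitary_diag:
  assumes "unitary n P"
  shows "trace_norm (P * mat_diag n (\<lambda>i. complex_of_real (d i)) * mat_adjoint P) = (\<Sum>i<n. \<bar>d i\<bar>)"
proof -
  have "mset (map f [0..<n]) = image_mset f (mset_set {..<n})" for f :: "nat \<Rightarrow> complex"
    by (simp add: lessThan_atLeast0)
  then show ?thesis
    unfolding trace_norm_def unitary_diag_adjoint[OF assms] unitary_diag_mult[OF assms]
      eigvals_unitary_diag[OF assms]
    by (simp add: image_mset.compositionality o_def sum_unfold_sum_mset[symmetric] flip: of_real_mult)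
qed

lemma trace_norm_nonneg:
  assumes "A \<in> carrier_mat n n" "hermitian A"
  shows "0 \<le> trace_norm A"
  using hermitian_spectral[OF assms] trace_norm_unitary_diag
  by (metis abs_ge_zero sum_nonneg)

section \<open>The trace norm as a maximum over unitaries\<close>

lemma unitary_row_norm:
  assumes "unitary n P" "i < n"
  shows "(\<Sum>k<n. (cmod (P $$ (i, k)))\<^sup>2) = 1"
proof -
  note c = unitaryD[OF assms(1)]
  have "complex_of_real (\<Sum>k<n. (cmod (P $$ (i, k)))\<^sup>2) = (P * mat_adjoint P) $$ (i, i)"
    using c(1) assms(2)
    by (simp add: index_mult_mat_sum[of _ n n _ n] complex_norm_square
        del: index_mult_mat(1) of_real_power)
  also have "\<dots> = complex_of_real 1"
    using assms(2) by (simp add: c(3))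
  finally show ?thesis
    by (simp only: of_real_eq_iff)
qed

lemma unitary_col_norm:
  assumes "unitary n P" "i < n"
  shows "(\<Sum>k<n. (cmod (P $$ (k, i)))\<^sup>2) = 1"
  using unitary_row_norm[OF unitary_adjoint[OF assms(1)] assms(2)] unitaryD(1)[OF assms(1)] assms(2)
  by simp

text \<open>Row j of A and column j of B are unit vectors, so bounding each product of moduli by the
  mean of the squares leaves total weight (1 + 1)/2 = 1 in front of c.\<close>

lemma unitary_diag_unitary_entry_le:
  assumes A: "unitary n A" and B: "unitary n B" and g: "\<And>k. k < n \<Longrightarrow> cmod (g k) \<le> c" and j: "j < n"
  shows "cmod ((A * mat_diag n g * B) $$ (j, j)) \<le> c"
proof -
  note Ac = unitaryD(1)[OF A] and Bc = unitaryD(1)[OF B]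
  have c0: "0 \<le> c"
    using g[OF j] by (meson norm_ge_zero order_trans)
  have am_gm: "x * y \<le> (x\<^sup>2 + y\<^sup>2) / 2" for x y :: real
    using sum_squares_bound[of x y] by simp
  have "(A * mat_diag n g * B) $$ (j, j) = (\<Sum>k<n. A $$ (j, k) * g k * B $$ (k, j))"
    using Bc j by (simp add: mat_diag_mult_right[OF Ac] index_mult_mat_sum[of _ n n _ n] del: index_mult_mat(1))
  also have "cmod \<dots> \<le> (\<Sum>k<n. cmod (A $$ (j, k) * g k * B $$ (k, j)))"
    by (rule norm_sum)
  also have "\<dots> \<le> (\<Sum>k<n. c * (((cmod (A $$ (j, k)))\<^sup>2 + (cmod (B $$ (k, j)))\<^sup>2) / 2))"
  proof (rule sum_mono)
    fix k assume "k \<in> {..<n}"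
    then have "cmod (A $$ (j, k) * g k * B $$ (k, j)) \<le> c * (cmod (A $$ (j, k)) * cmod (B $$ (k, j)))"
      using mult_right_mono[OF g[of k], of "cmod (A $$ (j, k)) * cmod (B $$ (k, j))"]
      by (simp add: norm_mult mult_ac)
    also have "\<dots> \<le> c * (((cmod (A $$ (j, k)))\<^sup>2 + (cmod (B $$ (k, j)))\<^sup>2) / 2)"
      by (intro mult_left_mono am_gm c0)
    finally show "cmod (A $$ (j, k) * g k * B $$ (k, j)) \<le> \<dots>" .
  qed
  also have "\<dots> = c * (((\<Sum>k<n. (cmod (A $$ (j, k)))\<^sup>2) + (\<Sum>k<n. (cmod (B $$ (k, j)))\<^sup>2)) / 2)"
    by (simp only: sum_distrib_left[symmetric] sum_divide_distrib[symmetric] sum.distrib)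
  also have "\<dots> = c"
    by (simp add: unitary_row_norm[OF A j] unitary_col_norm[OF B j])
  finally show ?thesis .
qed

text \<open>Hoelder's inequality between trace norm and operator norm; the factorisation into
  unitary, diagonal and unitary stands in for an operator of norm at most c. In the eigenbasis of X
  only the diagonal entries of that operator meet the eigenvalues of X.\<close>

lemma trace_norm_duality:
  assumes X: "X \<in> carrier_mat n n" "hermitian X"
    and A: "unitary n A" and B: "unitary n B" and g: "\<And>k. k < n \<Longrightarrow> cmod (g k) \<le> c"
  shows "cmod (mtrace (A * mat_diag n g * B * X)) \<le> c * trace_norm X"
proof -
  obtain P d where P: "unitary n P" and Xd: "X = P * mat_diag n (\<lambda>i. complex_of_real (d i)) * mat_adjoint P"
    using hermitian_spectral[OF X] .
  define M where "M = (mat_adjoint P * A) * mat_diag n g * (B * P)"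
  have Ac: "A \<in> carrier_mat n n" and Bc: "B \<in> carrier_mat n n" and Pc: "P \<in> carrier_mat n n"
    using A B P by (auto dest: unitaryD)
  have Mc: "M \<in> carrier_mat n n"
    using Ac Bc Pc by (auto simp: M_def)
  let ?D = "mat_diag n (\<lambda>i. complex_of_real (d i))"
  have "A * mat_diag n g * B * X = (A * mat_diag n g * (B * P) * ?D) * mat_adjoint P"
    using Ac[THEN carrier_dims] Bc[THEN carrier_dims] Pc[THEN carrier_dims]
    by (simp add: Xd mult_assoc_dim)
  then have "mtrace (A * mat_diag n g * B * X) = mtrace (mat_adjoint P * (A * mat_diag n g * (B * P) * ?D))"
    using Ac Bc Pc by (metis mtrace_mult_comm mult_carrier_mat mat_diag_dim mat_adjoint_carrier)
  also have "mat_adjoint P * (A * mat_diag n g * (B * P) * ?D) = M * ?D"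
    using Ac[THEN carrier_dims] Bc[THEN carrier_dims] Pc[THEN carrier_dims]
    by (simp add: M_def mult_assoc_dim)
  also have "mtrace (M * ?D) = (\<Sum>i<n. M $$ (i, i) * complex_of_real (d i))"
    by (simp add: mat_diag_mult_right[OF Mc] mtrace_def)
  also have "cmod \<dots> \<le> (\<Sum>i<n. cmod (M $$ (i, i) * complex_of_real (d i)))"
    by (rule norm_sum)
  also have "\<dots> \<le> (\<Sum>i<n. c * \<bar>d i\<bar>)"
    unfolding M_def norm_mult norm_of_real
    using A B P g
    by (intro sum_mono mult_right_mono unitary_diag_unitary_entry_le unitary_mult unitary_adjoint) auto
  also have "\<dots> = c * trace_norm X"
    unfolding Xd trace_norm_unitary_diag[OF P] by (simp add: sum_distrib_left)
  finally show ?thesis .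
qed

lemma mtrace_unitary_le_trace_norm:
  assumes X: "X \<in> carrier_mat n n" "hermitian X" and V: "unitary n V"
  shows "cmod (mtrace (V * X)) \<le> trace_norm X"
  using trace_norm_duality[OF X V unitary_one, of "\<lambda>_. 1" 1] unitaryD(1)[OF V] by simp

lemma trace_norm_attained:
  assumes X: "X \<in> carrier_mat n n" "hermitian X"
  obtains V where "unitary n V" "mtrace (V * X) = complex_of_real (trace_norm X)"
proof -
  obtain P d where P: "unitary n P" and Xd: "X = P * mat_diag n (\<lambda>i. complex_of_real (d i)) * mat_adjoint P"
    using hermitian_spectral[OF X] .
  \<comment> \<open>The sign of 0 is taken to be 1, since V has to be unitary.\<close>
  define s where "s i = (if d i \<ge> 0 then 1 else - 1 :: complex)" for i
  define V where "V = P * mat_diag n s * mat_adjoint P"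
  have V: "unitary n V"
    unfolding V_def by (intro unitary_mult P unitary_adjoint unitary_mat_diag) (simp add: s_def)
  have sd: "s i * complex_of_real (d i) = complex_of_real \<bar>d i\<bar>" for i
    by (simp add: s_def)
  have "mtrace (V * X) = mtrace (mat_diag n (\<lambda>i. complex_of_real \<bar>d i\<bar>))"
    unfolding V_def Xd unitary_diag_mult[OF P] sd by (rule mtrace_unitary_conj[OF P]) simp
  also have "\<dots> = complex_of_real (trace_norm X)"
    unfolding Xd trace_norm_unitary_diag[OF P] by (simp add: mtrace_def mat_diag_def)
  finally show ?thesis
    using V that by blast
qed

text \<open>With \<open>mtrace_unitary_le_trace_norm\<close> this is the variational
  characterisation of the trace norm; later inequalities are checked for one V at a time.\<close>

lemma trace_norm_leI:
  assumes X: "X \<in> carrier_mat n n" "hermitian X"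
    and le: "\<And>V. unitary n V \<Longrightarrow> cmod (mtrace (V * X)) \<le> c"
  shows "trace_norm X \<le> c"
proof -
  obtain V where V: "unitary n V" "mtrace (V * X) = complex_of_real (trace_norm X)"
    using trace_norm_attained[OF X] .
  show ?thesis
    using le[OF V(1)] by (simp add: V(2))
qed

lemma hermitian_add:
  assumes "A \<in> carrier_mat n n" "B \<in> carrier_mat n n" "hermitian A" "hermitian B"
  shows "hermitian (A + B)"
  using assms mat_adjoint_add[OF assms(1,2)] by (simp add: hermitian_def)

lemma hermitian_minus:
  assumes "A \<in> carrier_mat n n" "B \<in> carrier_mat n n" "hermitian A" "hermitian B"
  shows "hermitian (A - B)"
  using assms mat_adjoint_minus[OF assms(1,2)] by (simp add: hermitian_def)

lemma trace_norm_triangle: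
  assumes A: "A \<in> carrier_mat n n" "hermitian A" and B: "B \<in> carrier_mat n n" "hermitian B"
  shows "trace_norm (A + B) \<le> trace_norm A + trace_norm B"
proof (rule trace_norm_leI)
  fix V assume V: "unitary n V"
  note Vc = unitaryD(1)[OF V]
  have "mtrace (V * (A + B)) = mtrace (V * A) + mtrace (V * B)"
    using A B Vc by (simp add: mult_add_distrib_mat[of _ n n] mtrace_add[of _ n])
  then show "cmod (mtrace (V * (A + B))) \<le> trace_norm A + trace_norm B"
    using norm_triangle_mono mtrace_unitary_le_trace_norm[OF A V] mtrace_unitary_le_trace_norm[OF B V]
    by metis
qed (use A B hermitian_add in auto)

lemma trace_norm_triangle_minus:
  assumes A: "A \<in> carrier_mat n n" "hermitian A" and B: "B \<in> carrier_mat n n" "hermitian B"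
  shows "trace_norm (A - B) \<le> trace_norm A + trace_norm B"
proof (rule trace_norm_leI)
  fix V assume V: "unitary n V"
  note Vc = unitaryD(1)[OF V]
  have "mtrace (V * (A - B)) = mtrace (V * A) - mtrace (V * B)"
    using A B Vc by (simp add: mult_minus_distrib_mat[of _ n n] mtrace_minus[of _ n])
  then show "cmod (mtrace (V * (A - B))) \<le> trace_norm A + trace_norm B"
    using norm_triangle_ineq4 add_mono mtrace_unitary_le_trace_norm[OF A V] mtrace_unitary_le_trace_norm[OF B V]
    by (metis order_trans)
qed (use A B hermitian_minus in auto)

lemma mtrace_rotate:
  assumes "A \<in> carrier_mat n n" "B \<in> carrier_mat n n" "C \<in> carrier_mat n n"
  shows "mtrace (A * (B * C)) = mtrace (C * A * B)"
  using assms mtrace_mult_comm[of "A * B" n n C] by (simp add: mult_assoc_dim carrier_dims)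

lemma trace_norm_unitary_conj_le:
  assumes X: "X \<in> carrier_mat n n" "hermitian X" and U: "unitary n U"
  shows "trace_norm (U * X * mat_adjoint U) \<le> trace_norm X"
proof (rule trace_norm_leI)
  fix V assume V: "unitary n V"
  note Uc = unitaryD(1)[OF U] and Vc = unitaryD(1)[OF V]
  \<comment> \<open>Cyclicity replaces V by its conjugate under U, which is again unitary.\<close>
  have "mtrace (V * (U * X * mat_adjoint U)) = mtrace (mat_adjoint U * V * (U * X))"
    using Uc Vc X by (intro mtrace_rotate) auto
  also have "\<dots> = mtrace (mat_adjoint U * V * U * X)"
    using Uc[THEN carrier_dims] Vc[THEN carrier_dims] X(1)[THEN carrier_dims] by (simp add: mult_assoc_dim)
  finally show "cmod (mtrace (V * (U * X * mat_adjoint U))) \<le> trace_norm X"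
    using mtrace_unitary_le_trace_norm[OF X] U V by (metis unitary_mult unitary_adjoint)
qed (use X unitaryD(1)[OF U] hermitian_conj in auto)

lemma trace_norm_half:
  assumes X: "X \<in> carrier_mat n n" "hermitian X"
  shows "trace_norm ((1/2) \<cdot>\<^sub>m X) \<le> trace_norm X / 2" "hermitian ((1/2) \<cdot>\<^sub>m X)"
proof -
  show h: "hermitian ((1/2) \<cdot>\<^sub>m X)"
    using X by (intro hermitianI[of _ n]) (auto simp: hermitian_index[OF X(2,1), symmetric])
  show "trace_norm ((1/2) \<cdot>\<^sub>m X) \<le> trace_norm X / 2"
  proof (rule trace_norm_leI[of _ n, OF _ h])
    fix V assume V: "unitary n V"
    have "mtrace (V * ((1/2) \<cdot>\<^sub>m X)) = mtrace (V * X) / 2"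
      using X(1) unitaryD(1)[OF V]
      by (simp add: mult_smult_distrib[of _ n n _ n] mtrace_def sum_divide_distrib del: index_mult_mat(1))
    then have "cmod (mtrace (V * ((1/2) \<cdot>\<^sub>m X))) = cmod (mtrace (V * X)) / 2"
      by (simp only: norm_divide norm_numeral)
    then show "cmod (mtrace (V * ((1/2) \<cdot>\<^sub>m X))) \<le> trace_norm X / 2"
      using mtrace_unitary_le_trace_norm[OF X V] by simp
  qed (use X in auto)
qed

text \<open>Positivity makes the eigenvalues nonnegative, so the sum of their absolute values is the
  trace.\<close>

lemma trace_norm_density:
  assumes "density n \<rho>"
  shows "trace_norm \<rho> = 1"
proof -
  let ?N = "2 ^ n :: nat"
  have c: "\<rho> \<in> carrier_mat ?N ?N" and h: "hermitian \<rho>" and psd: "psd \<rho>" and tr: "mtrace \<rho> = 1"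
    using assms by (auto simp: density_def)
  obtain P d where P: "unitary ?N P"
    and \<rho>: "\<rho> = P * mat_diag ?N (\<lambda>i. complex_of_real (d i)) * mat_adjoint P"
    using hermitian_spectral[OF c h] .
  note Pc = unitaryD(1)[OF P]
  let ?D = "mat_diag ?N (\<lambda>i. complex_of_real (d i))"
  have D: "mat_adjoint P * (\<rho> * P) = ?D"
  proof -
    have "mat_adjoint P * (\<rho> * P) = mat_adjoint P * (P * (?D * (mat_adjoint P * P)))"
      using Pc[THEN carrier_dims] by (simp add: \<rho> mult_assoc_dim)
    also have "\<dots> = mat_adjoint P * (P * ?D)"
      by (simp add: unitaryD(2)[OF P] right_mult_one_mat[of _ ?N ?N])
    finally show ?thesis
      using mult_adjoint_cancel(1)[OF P, of ?D ?N] by simp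
  qed
  \<comment> \<open>An eigenvalue is the value of the quadratic form of the state at the
    corresponding column of P.\<close>
  have "0 \<le> d i" if i: "i < ?N" for i
  proof -
    have "complex_of_real (d i) = (mat_adjoint P * (\<rho> * P)) $$ (i, i)"
      unfolding D using i by (simp add: mat_diag_def)
    also have "\<dots> = (\<Sum>k<?N. cnj (P $$ (k, i)) * (\<rho> * P) $$ (k, i))"
      using i Pc c by (simp add: index_mult_mat_sum[of "mat_adjoint P" ?N ?N _ ?N] del: index_mult_mat(1))
    also have "\<dots> = (\<rho> *\<^sub>v col P i) \<bullet>c col P i"
      unfolding scalar_prod_def using i Pc c
      by (auto simp: lessThan_atLeast0 mult.commute intro!: sum.cong)
    finally show ?thesis
      using psd i Pc c unfolding psd_def
      by (metis Re_complex_of_real carrier_matD(1,2) col_carrier_vec)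
  qed
  moreover have "complex_of_real (\<Sum>i<?N. d i) = 1"
  proof -
    have "mtrace \<rho> = mtrace ?D"
      unfolding \<rho> by (rule mtrace_unitary_conj[OF P]) simp
    then show ?thesis
      unfolding tr by (simp add: mtrace_def mat_diag_def)
  qed
  then have "(\<Sum>i<?N. d i) = 1"
    by (metis of_real_eq_1_iff)
  ultimately show ?thesis
    unfolding \<rho> trace_norm_unitary_diag[OF P] by simp
qed

subsection \<open>Depolarising a qubit\<close>

text \<open>Passes from the arithmetic encoding of qubits to \<open>bit\<close>, where
  \<open>flip_bit\<close> and bitwise extensionality are available.\<close>

lemma qbit_eq_iff: "qbit a i = qbit b i \<longleftrightarrow> (bit a i \<longleftrightarrow> bit b i)"
  by (auto simp: qbit_def bit_iff_odd odd_iff_mod_2_eq_one even_iff_mod_2_eq_zero)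

lemma flip_bit_less:
  assumes "i < n" "a < (2::nat) ^ n"
  shows "flip_bit i a < 2 ^ n"
proof -
  have "take_bit n (flip_bit i a) = flip_bit i a"
    using assms by (simp add: take_bit_flip_bit_eq take_bit_nat_eq_self)
  then show ?thesis
    by (metis take_bit_nat_less_exp)
qed

lemma flip_bit_flip_bit [simp]: "flip_bit i (flip_bit i a) = (a :: nat)"
  by (rule bit_eqI) (auto simp: bit_simps)

lemma flip_bit_commute: "flip_bit i (flip_bit j a) = flip_bit j (flip_bit i (a :: nat))"
  by (rule bit_eqI) (auto simp: bit_simps)

lemma bit_flip_bit_nat [simp]: "bit (flip_bit i (a::nat)) j \<longleftrightarrow> (if i = j then \<not> bit a j else bit a j)"
  by (auto simp: bit_simps)

lemma sum_flip_bit: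
  fixes f :: "nat \<Rightarrow> 'a :: comm_monoid_add"
  assumes "i < n"
  shows "(\<Sum>a<2^n. f (flip_bit i a)) = (\<Sum>a<2^n. f a)"
  by (rule sum.reindex_bij_witness[of _ "flip_bit i" "flip_bit i"]) (auto simp: flip_bit_less[OF assms])

text \<open>The channel $X \mapsto \frac{I}{2} \otimes \mathrm{Tr}_i X$ that completely depolarises qubit $i$.\<close>

definition depol :: "nat \<Rightarrow> nat \<Rightarrow> complex mat \<Rightarrow> complex mat" where
  "depol n i X = mat (2 ^ n) (2 ^ n) (\<lambda>(a, b).
     if bit a i = bit b i then (X $$ (a, b) + X $$ (flip_bit i a, flip_bit i b)) / 2 else 0)"

lemma depol_carrier [simp]: "depol n i X \<in> carrier_mat (2 ^ n) (2 ^ n)"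
  by (simp add: depol_def)

lemma depol_dim [simp]: "dim_row (depol n i X) = 2 ^ n" "dim_col (depol n i X) = 2 ^ n"
  by (simp_all add: depol_def)

lemma depol_index:
  "a < 2 ^ n \<Longrightarrow> b < 2 ^ n \<Longrightarrow> depol n i X $$ (a, b) =
     (if bit a i = bit b i then (X $$ (a, b) + X $$ (flip_bit i a, flip_bit i b)) / 2 else 0)"
  by (simp add: depol_def)

lemma hermitian_depol:
  assumes X: "X \<in> carrier_mat (2 ^ n) (2 ^ n)" "hermitian X" and i: "i < n"
  shows "hermitian (depol n i X)"
  by (rule hermitianI[OF depol_carrier])
    (auto simp: depol_index hermitian_index[OF X(2,1), symmetric] flip_bit_less[OF i])

lemma mtrace_depol:
  assumes X: "X \<in> carrier_mat (2 ^ n) (2 ^ n)" and i: "i < n"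
  shows "mtrace (depol n i X) = mtrace X"
proof -
  have "mtrace (depol n i X) = ((\<Sum>a<2^n. X $$ (a, a)) + (\<Sum>a<2^n. X $$ (flip_bit i a, flip_bit i a))) / 2"
    by (simp add: mtrace_def depol_index sum_divide_distrib sum.distrib add_divide_distrib)
  also have "\<dots> = mtrace X"
    using X by (simp add: sum_flip_bit[OF i, of "\<lambda>a. X $$ (a, a)"] mtrace_def)
  finally show ?thesis .
qed

lemma trace_norm_unitary_average_le:
  assumes X: "X \<in> carrier_mat n n" "hermitian X" and U: "unitary n U"
  shows "trace_norm ((1/2) \<cdot>\<^sub>m (X + U * X * mat_adjoint U)) \<le> trace_norm X"
    "hermitian ((1/2) \<cdot>\<^sub>m (X + U * X * mat_adjoint U))"
proof -
  note Uc = unitaryD(1)[OF U]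
  have c: "U * X * mat_adjoint U \<in> carrier_mat n n" "hermitian (U * X * mat_adjoint U)"
    using X Uc hermitian_conj by auto
  have s: "X + U * X * mat_adjoint U \<in> carrier_mat n n" "hermitian (X + U * X * mat_adjoint U)"
    using X c hermitian_add by auto
  show "hermitian ((1/2) \<cdot>\<^sub>m (X + U * X * mat_adjoint U))"
    using trace_norm_half[OF s] by simp
  show "trace_norm ((1/2) \<cdot>\<^sub>m (X + U * X * mat_adjoint U)) \<le> trace_norm X"
    using trace_norm_half(1)[OF s] trace_norm_triangle[OF X c] trace_norm_unitary_conj_le[OF X U]
    by linarith
qed

text \<open>Depolarising is averaging over conjugation by the Pauli matrix $Z_i$ and then by $X_i$.\<close>

lemma trace_norm_depol_le:
  assumes X: "X \<in> carrier_mat (2 ^ n) (2 ^ n)" "hermitian X" and i: "i < n"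
  shows "trace_norm (depol n i X) \<le> trace_norm X"
proof -
  let ?N = "2 ^ n :: nat"
  define z where "z a = (if bit a i then - 1 else 1 :: complex)" for a :: nat
  define Z where "Z = mat_diag ?N z"
  define F where "F = mat ?N ?N (\<lambda>(a, b). if b = flip_bit i a then 1 else 0 :: complex)"
  have Z: "unitary ?N Z"
    unfolding Z_def by (rule unitary_mat_diag) (simp add: z_def)
  have Fc: "F \<in> carrier_mat ?N ?N"
    by (simp add: F_def)
  have F_mult: "(F * A) $$ (a, b) = A $$ (flip_bit i a, b)"
    if "A \<in> carrier_mat ?N ?N" "a < ?N" "b < ?N" for A a b
  proof -
    have "(F * A) $$ (a, b) = (\<Sum>k<?N. if k = flip_bit i a then A $$ (k, b) else 0)"
      unfolding index_mult_mat_sum[OF Fc that]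
      using that by (intro sum.cong) (auto simp: F_def)
    then show ?thesis
      using flip_bit_less[OF i that(2)] by simp
  qed
  have mult_F: "(A * mat_adjoint F) $$ (a, b) = A $$ (a, flip_bit i b)"
    if "A \<in> carrier_mat ?N ?N" "a < ?N" "b < ?N" for A a b
  proof -
    have "(A * mat_adjoint F) $$ (a, b) = (\<Sum>k<?N. if k = flip_bit i b then A $$ (a, k) else 0)"
      unfolding index_mult_mat_sum[OF that(1) mat_adjoint_carrier[OF Fc] that(2,3)]
      using that by (intro sum.cong) (auto simp: F_def)
    then show ?thesis
      using flip_bit_less[OF i that(3)] by simp
  qed
  have "F * mat_adjoint F = 1\<^sub>m ?N"
  proof (rule eq_matI)
    fix a b assume "a < dim_row (1\<^sub>m ?N :: complex mat)" "b < dim_col (1\<^sub>m ?N :: complex mat)"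
    then have ab: "a < ?N" "b < ?N" by auto
    have "flip_bit i b = flip_bit i a \<longleftrightarrow> a = b"
      by (metis flip_bit_flip_bit)
    then show "(F * mat_adjoint F) $$ (a, b) = 1\<^sub>m ?N $$ (a, b)"
      unfolding mult_F[OF Fc ab] using ab flip_bit_less[OF i ab(2)] by (simp add: F_def)
  qed (use Fc in auto)
  then have "mat_adjoint F * F = 1\<^sub>m ?N"
    using mat_mult_left_right_inverse[OF Fc mat_adjoint_carrier[OF Fc]] by simp
  then have F: "unitary ?N F"
    using Fc by (simp add: unitary_def)
  define Y where "Y = (1/2) \<cdot>\<^sub>m (X + Z * X * mat_adjoint Z)"
  have ZXZ: "Z * X * mat_adjoint Z = mat ?N ?N (\<lambda>(a, b). z a * X $$ (a, b) * cnj (z b))"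
    unfolding Z_def mat_adjoint_mat_diag mat_diag_mult_left[OF X(1)]
    by (subst mat_diag_mult_right[of _ ?N]) (auto intro!: eq_matI)
  have Yc: "Y \<in> carrier_mat ?N ?N"
    unfolding Y_def ZXZ using X by simp
  \<comment> \<open>Conjugation by Z multiplies an entry by \<open>z a * cnj (z b)\<close>, which is
    -1 exactly when a and b differ in bit i, so the average deletes these entries. Averaging over F
    afterwards contributes the flipped entry.\<close>
  have Y_index: "Y $$ (a, b) = (if bit a i = bit b i then X $$ (a, b) else 0)" if "a < ?N" "b < ?N" for a b
    using that X unfolding Y_def ZXZ by (auto simp: z_def)
  have Y: "hermitian Y" "trace_norm Y \<le> trace_norm X"
    unfolding Y_def using trace_norm_unitary_average_le[OF X Z] by auto
  have "depol n i X = (1/2) \<cdot>\<^sub>m (Y + F * Y * mat_adjoint F)"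
  proof (rule eq_matI)
    fix a b assume "a < dim_row ((1/2) \<cdot>\<^sub>m (Y + F * Y * mat_adjoint F))"
      "b < dim_col ((1/2) \<cdot>\<^sub>m (Y + F * Y * mat_adjoint F))"
    then have ab: "a < ?N" "b < ?N"
      using Fc Yc by auto
    have "(F * Y * mat_adjoint F) $$ (a, b) = Y $$ (flip_bit i a, flip_bit i b)"
      using Fc Yc ab flip_bit_less[OF i] by (simp add: mult_F F_mult del: index_mult_mat(1))
    then show "depol n i X $$ (a, b) = ((1/2) \<cdot>\<^sub>m (Y + F * Y * mat_adjoint F)) $$ (a, b)"
      using Fc Yc ab flip_bit_less[OF i]
      by (simp add: depol_index Y_index del: index_mult_mat(1))
  qed (use Fc Yc in auto)
  then show ?thesis
    using trace_norm_unitary_average_le(1)[OF Yc Y(1) F] Y(2) by simp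
qed

text \<open>The channel is self-adjoint for the trace pairing. Of the two summands, \<open>g\<close>
  is the unflipped one and \<open>f\<close> the flipped one; reindexing the sum of \<open>f\<close>
  by the involution \<open>flip_bit\<close> moves the flip from X to M.\<close>

lemma mtrace_depol_swap:
  assumes M: "M \<in> carrier_mat (2 ^ n) (2 ^ n)" and X: "X \<in> carrier_mat (2 ^ n) (2 ^ n)" and i: "i < n"
  shows "mtrace (M * depol n i X) = mtrace (depol n i M * X)"
proof -
  let ?N = "2 ^ n :: nat"
  define f where "f a b = (if bit a i = bit b i then M $$ (a, b) * X $$ (flip_bit i b, flip_bit i a) else 0)" for a b
  define g where "g a b = (if bit a i = bit b i then M $$ (a, b) * X $$ (b, a) else 0)" for a b
  have "mtrace (M * depol n i X) = (\<Sum>a<?N. \<Sum>b<?N. (g a b + f a b) / 2)"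
    unfolding mtrace_mult[OF M depol_carrier]
    by (intro sum.cong refl) (auto simp: depol_index f_def g_def field_simps)
  also have "\<dots> = ((\<Sum>a<?N. \<Sum>b<?N. g a b) + (\<Sum>a<?N. \<Sum>b<?N. f a b)) / 2"
    by (simp add: sum.distrib add_divide_distrib flip: sum_divide_distrib)
  also have "(\<Sum>a<?N. \<Sum>b<?N. f a b) = (\<Sum>a<?N. \<Sum>b<?N. f (flip_bit i a) (flip_bit i b))"
    by (simp add: sum_flip_bit[OF i, of "\<lambda>b. f (flip_bit i _) b"]
        sum_flip_bit[OF i, of "\<lambda>a. \<Sum>b<?N. f a b"])
  also have "((\<Sum>a<?N. \<Sum>b<?N. g a b) + (\<Sum>a<?N. \<Sum>b<?N. f (flip_bit i a) (flip_bit i b))) / 2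
      = (\<Sum>a<?N. \<Sum>b<?N. (g a b + f (flip_bit i a) (flip_bit i b)) / 2)"
    by (simp add: sum.distrib add_divide_distrib flip: sum_divide_distrib)
  also have "\<dots> = mtrace (depol n i M * X)"
    unfolding mtrace_mult[OF depol_carrier X]
    by (intro sum.cong refl) (auto simp: depol_index f_def g_def field_simps)
  finally show ?thesis .
qed

text \<open>Operators of the form $I_i \otimes M'$, acting trivially on qubit $i$.\<close>

definition trivial_on :: "nat \<Rightarrow> nat \<Rightarrow> complex mat \<Rightarrow> bool" where
  "trivial_on n i M \<longleftrightarrow> (\<forall>a<2^n. \<forall>b<2^n. (bit a i \<noteq> bit b i \<longrightarrow> M $$ (a, b) = 0)
     \<and> M $$ (flip_bit i a, flip_bit i b) = M $$ (a, b))"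

lemma trivial_on_depol: "i < n \<Longrightarrow> trivial_on n i (depol n i M)"
  by (auto simp: trivial_on_def depol_index flip_bit_less)

lemma trivial_on_depol_other:
  assumes "trivial_on n i M" "i < n" "j < n"
  shows "trivial_on n i (depol n j M)"
proof (cases "i = j")
  case False
  then show ?thesis
    using assms unfolding trivial_on_def
    by (auto simp: depol_index flip_bit_less flip_bit_commute[of j i])
qed (use trivial_on_depol assms in auto)

text \<open>Depolarising a qubit creates triviality on it, and depolarising further qubits does not
  destroy it.\<close>

lemma trivial_on_foldr_depol:
  assumes "set is \<subseteq> {..<n}" "i \<in> set is"
  shows "trivial_on n i (foldr (depol n) is M)"
  using assms by (induction "is") (auto intro: trivial_on_depol trivial_on_depol_other)

lemma fold_depol_carrier:
  "X \<in> carrier_mat (2 ^ n) (2 ^ n) \<Longrightarrow> fold (depol n) is X \<in> carrier_mat (2 ^ n) (2 ^ n)"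
  by (induction "is" arbitrary: X) auto

lemma foldr_depol_carrier:
  "X \<in> carrier_mat (2 ^ n) (2 ^ n) \<Longrightarrow> foldr (depol n) is X \<in> carrier_mat (2 ^ n) (2 ^ n)"
  by (induction "is") auto

text \<open>The adjoint of a composition is the composition in reverse order, hence
  \<open>fold\<close> on one side and \<open>foldr\<close> on the other.\<close>

lemma mtrace_fold_depol:
  assumes "M \<in> carrier_mat (2 ^ n) (2 ^ n)" "X \<in> carrier_mat (2 ^ n) (2 ^ n)" "set is \<subseteq> {..<n}"
  shows "mtrace (M * fold (depol n) is X) = mtrace (foldr (depol n) is M * X)"
  using assms
proof (induction "is" arbitrary: X)
  case (Cons i "is")
  then show ?case
    by (simp add: mtrace_depol_swap foldr_depol_carrier)
qed auto

lemma mtrace_mult_eqI: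
  assumes X: "X \<in> carrier_mat N N" and Y: "Y \<in> carrier_mat N N"
    and eq: "\<And>M. M \<in> carrier_mat N N \<Longrightarrow> mtrace (M * X) = mtrace (M * Y)"
  shows "X = Y"
proof (rule eq_matI)
  fix a b assume "a < dim_row Y" "b < dim_col Y"
  then have ab: "a < N" "b < N"
    using Y by auto
  \<comment> \<open>The matrix unit with its 1 at position (b, a): pairing with it reads off the
    entry at (a, b).\<close>
  define E where "E = mat N N (\<lambda>(i, j). if i = b \<and> j = a then 1 else 0 :: complex)"
  have E: "E \<in> carrier_mat N N"
    by (simp add: E_def)
  have "mtrace (E * Z) = Z $$ (a, b)" if "Z \<in> carrier_mat N N" for Z
  proof -
    have "mtrace (E * Z) = (\<Sum>i<N. \<Sum>j<N. if j = a then if i = b then Z $$ (j, i) else 0 else 0)"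
      unfolding mtrace_mult[OF E that] by (intro sum.cong refl) (auto simp: E_def)
    then show ?thesis
      using ab by simp
  qed
  then show "X $$ (a, b) = Y $$ (a, b)"
    using eq[OF E] X Y by metis
qed (use X Y in auto)

text \<open>This is the dual form of the vanishing partial trace over the support of U. After the
  channels have moved to M, the result M' commutes with U, so tr(M' U X U^dagger) = tr(U M' X
  U^dagger) = tr(M' X).\<close>

lemma fold_depol_minus_conj:
  assumes comm: "\<And>M. M \<in> carrier_mat (2 ^ n) (2 ^ n) \<Longrightarrow> (\<And>i. i \<in> set is \<Longrightarrow> trivial_on n i M)
      \<Longrightarrow> M * U = U * M"
    and U: "unitary (2 ^ n) U" and X: "X \<in> carrier_mat (2 ^ n) (2 ^ n)" and "is": "set is \<subseteq> {..<n}"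
  shows "fold (depol n) is (X - U * X * mat_adjoint U) = 0\<^sub>m (2 ^ n) (2 ^ n)"
proof (rule mtrace_mult_eqI)
  note Uc = unitaryD(1)[OF U]
  let ?c = "carrier_mat (2 ^ n) (2 ^ n)"
  have UXU: "U * X * mat_adjoint U \<in> ?c"
    using Uc X by auto
  then have diff: "X - U * X * mat_adjoint U \<in> ?c"
    by (rule minus_carrier_mat)
  then show "fold (depol n) is (X - U * X * mat_adjoint U) \<in> ?c"
    by (rule fold_depol_carrier)
  fix M :: "complex mat" assume M: "M \<in> ?c"
  define M' where "M' = foldr (depol n) is M"
  have M'c: "M' \<in> ?c"
    using foldr_depol_carrier[OF M] by (simp add: M'_def)
  have MU: "M' * U = U * M'"
    using comm[OF M'c] trivial_on_foldr_depol[OF "is"] by (simp add: M'_def)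
  have "M' * (U * X * mat_adjoint U) = M' * U * X * mat_adjoint U"
    using M'c[THEN carrier_dims] X[THEN carrier_dims] Uc[THEN carrier_dims] by (simp add: mult_assoc_dim)
  also have "\<dots> = U * (M' * X) * mat_adjoint U"
    unfolding MU
    using M'c[THEN carrier_dims] X[THEN carrier_dims] Uc[THEN carrier_dims] by (simp add: mult_assoc_dim)
  also have "mtrace \<dots> = mtrace (M' * X)"
    using M'c X by (intro mtrace_unitary_conj[OF U]) auto
  finally have eq: "mtrace (M' * (U * X * mat_adjoint U)) = mtrace (M' * X)" .
  have "mtrace (M * fold (depol n) is (X - U * X * mat_adjoint U)) = mtrace (M' * (X - U * X * mat_adjoint U))"
    unfolding M'_def by (rule mtrace_fold_depol[OF M diff "is"])
  also have "M' * (X - U * X * mat_adjoint U) = M' * X - M' * (U * X * mat_adjoint U)"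
    by (rule mult_minus_distrib_mat[OF M'c X UXU])
  also have "mtrace \<dots> = 0"
    using M'c X UXU eq by (subst mtrace_minus[of _ "2 ^ n"]) auto
  also have "\<dots> = mtrace (M * 0\<^sub>m (2 ^ n) (2 ^ n))"
    using M by (simp add: mtrace_def)
  finally show "mtrace (M * fold (depol n) is (X - U * X * mat_adjoint U)) = mtrace (M * 0\<^sub>m (2 ^ n) (2 ^ n))" .
qed auto

subsection \<open>Bounding the Wasserstein norm\<close>

text \<open>The two indices that a partial trace over qubit i sums over form a pair exchanged by
  \<open>flip_bit\<close>, the operation in which \<open>depol\<close> is expressed.\<close>

lemma ins_bit_props:
  assumes "i < n" "a < 2 ^ (n - 1)"
  shows "ins_bit i 0 a < 2 ^ n" "ins_bit i 1 a < 2 ^ n" "\<not> bit (ins_bit i 0 a) i"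
    "flip_bit i (ins_bit i 0 a) = ins_bit i 1 a"
proof -
  define r q where "r = a mod 2 ^ i" and "q = a div 2 ^ i"
  have r: "r < 2 ^ i"
    by (simp add: r_def)
  \<comment> \<open>The digits r lie below position i, c occupies position i, and the digits of q
    lie above it.\<close>
  have ins: "ins_bit i c a = r + 2 ^ i * (c + 2 * q)" for c
    by (simp add: ins_bit_def r_def q_def algebra_simps)
  have "(2::nat) ^ (n - 1) = 2 ^ (n - 1 - i) * 2 ^ i"
    using assms(1) by (simp flip: power_add)
  then have "q < 2 ^ (n - 1 - i)"
    unfolding q_def using assms(2) by (intro less_mult_imp_div_less) simp
  then have "2 * q + 2 \<le> 2 * 2 ^ (n - 1 - i)"
    by simp
  then have "2 ^ i * (2 * q + 2) \<le> 2 ^ i * (2 * 2 ^ (n - 1 - i))"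
    by (rule mult_left_mono) simp
  also have "\<dots> = 2 ^ (i + Suc (n - 1 - i))"
    by (simp add: power_add)
  also have "i + Suc (n - 1 - i) = n"
    using assms(1) by simp
  finally show "ins_bit i 0 a < 2 ^ n" "ins_bit i 1 a < 2 ^ n"
    using r by (auto simp: ins algebra_simps)
  have "ins_bit i 0 a div 2 ^ i = 2 * q"
    using r by (simp add: ins)
  then show *: "\<not> bit (ins_bit i 0 a) i"
    by (simp add: bit_iff_odd)
  show "flip_bit i (ins_bit i 0 a) = ins_bit i 1 a"
    using * by (simp add: flip_bit_eq_if set_bit_eq ins)
qed

text \<open>The partial trace adds two entries related by a flip. Depolarising replaces both by
  their mean, which preserves the sum.\<close>

lemma ptrace_minus_depol:
  assumes X: "X \<in> carrier_mat (2 ^ n) (2 ^ n)" and i: "i < n"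
  shows "ptrace n i (X - depol n i X) = 0\<^sub>m (2 ^ (n - 1)) (2 ^ (n - 1))"
proof (rule eq_matI)
  fix a b assume "a < dim_row (0\<^sub>m (2 ^ (n - 1)) (2 ^ (n - 1)) :: complex mat)"
    "b < dim_col (0\<^sub>m (2 ^ (n - 1)) (2 ^ (n - 1)) :: complex mat)"
  then have ab: "a < 2 ^ (n - 1)" "b < 2 ^ (n - 1)"
    by auto
  note ia = ins_bit_props[OF i ab(1)] and ib = ins_bit_props[OF i ab(2)]
  have fl: "flip_bit i (ins_bit i 1 a) = ins_bit i 0 a" "flip_bit i (ins_bit i 1 b) = ins_bit i 0 b"
    unfolding ia(4)[symmetric] ib(4)[symmetric] by simp_all
  have bt: "bit (ins_bit i 1 a) i" "bit (ins_bit i 1 b) i"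
    unfolding ia(4)[symmetric] ib(4)[symmetric] using ia(3) ib(3) by simp_all
  have D: "depol n i X $$ (ins_bit i 0 a, ins_bit i 0 b)
      = (X $$ (ins_bit i 0 a, ins_bit i 0 b) + X $$ (ins_bit i 1 a, ins_bit i 1 b)) / 2"
    "depol n i X $$ (ins_bit i 1 a, ins_bit i 1 b)
      = (X $$ (ins_bit i 1 a, ins_bit i 1 b) + X $$ (ins_bit i 0 a, ins_bit i 0 b)) / 2"
    using ia ib fl bt by (simp_all add: depol_index del: One_nat_def)
  show "ptrace n i (X - depol n i X) $$ (a, b) = 0\<^sub>m (2 ^ (n - 1)) (2 ^ (n - 1)) $$ (a, b)"
    using ab ia(1,2) ib(1,2) X unfolding ptrace_def
    by (simp add: D del: One_nat_def) (simp add: field_simps)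
qed (auto simp: ptrace_def)

definition W1_decomposition :: "nat \<Rightarrow> complex mat \<Rightarrow> (nat \<Rightarrow> complex mat) \<Rightarrow> bool" where
  "W1_decomposition n A X \<longleftrightarrow>
     (\<forall>i<n. obs0 n (X i) \<and> ptrace n i (X i) = 0\<^sub>m (2^(n-1)) (2^(n-1))) \<and> A = msum (2^n) n X"

text \<open>Carrying a witnessing decomposition instead of a bound on \<open>W1_norm\<close> lets
  witnesses be added directly, without near-minimisers of an infimum, and guarantees that the set
  under \<open>Inf\<close> is nonempty.\<close>

definition W1_bounded :: "nat \<Rightarrow> complex mat \<Rightarrow> real \<Rightarrow> bool" where
  "W1_bounded n A c \<longleftrightarrow> (\<exists>X. W1_decomposition n A X \<and> (1/2) * (\<Sum>i<n. trace_norm (X i)) \<le> c)"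

lemma W1_norm_le:
  assumes "W1_bounded n A c"
  shows "W1_norm n A \<le> c"
proof -
  obtain X where X: "W1_decomposition n A X" "(1/2) * (\<Sum>i<n. trace_norm (X i)) \<le> c"
    using assms by (auto simp: W1_bounded_def)
  have "W1_norm n A \<le> (1/2) * (\<Sum>i<n. trace_norm (X i))"
    unfolding W1_norm_def
  proof (rule cInf_lower)
    \<comment> \<open>\<open>cInf_lower\<close> needs a lower bound; trace norms of Hermitian
      matrices are nonnegative.\<close>
    show "bdd_below {(1/2) * (\<Sum>i<n. trace_norm (X i)) | X.
      (\<forall>i<n. obs0 n (X i) \<and> ptrace n i (X i) = 0\<^sub>m (2^(n-1)) (2^(n-1))) \<and> A = msum (2^n) n X}"
    proof (rule bdd_belowI[of _ 0], clarify)
      fix X assume X: "\<forall>i<n. obs0 n (X i) \<and> ptrace n i (X i) = 0\<^sub>m (2^(n-1)) (2^(n-1))"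
      have "0 \<le> (\<Sum>i<n. trace_norm (X i))"
        by (rule sum_nonneg) (use X trace_norm_nonneg in \<open>auto simp: obs0_def\<close>)
      then show "0 \<le> (1/2) * (\<Sum>i<n. trace_norm (X i))"
        by simp
    qed
  qed (use X(1) in \<open>auto simp: W1_decomposition_def\<close>)
  then show ?thesis
    using X(2) by simp
qed

lemma W1_bounded_mono: "W1_bounded n A c \<Longrightarrow> c \<le> d \<Longrightarrow> W1_bounded n A d"
  by (fastforce simp: W1_bounded_def)

lemma obs0_zero: "obs0 n (0\<^sub>m (2 ^ n) (2 ^ n))"
  by (auto simp: obs0_def mtrace_def intro!: hermitianI[of _ "2 ^ n"])

lemma trace_norm_zero: "trace_norm (0\<^sub>m N N) = 0"
proof -
  have "mat_diag N (\<lambda>i. complex_of_real 0) = 0\<^sub>m N N"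
    by (auto simp: mat_diag_def intro!: eq_matI)
  then show ?thesis
    using trace_norm_unitary_diag[OF unitary_one, of N "\<lambda>_. 0"] by simp
qed

lemma ptrace_zero:
  assumes "i < n"
  shows "ptrace n i (0\<^sub>m (2 ^ n) (2 ^ n)) = 0\<^sub>m (2 ^ (n - 1)) (2 ^ (n - 1))"
  using ins_bit_props[OF assms] by (auto simp: ptrace_def intro!: eq_matI)

lemma ptrace_add:
  assumes "A \<in> carrier_mat (2 ^ n) (2 ^ n)" "B \<in> carrier_mat (2 ^ n) (2 ^ n)" "i < n"
  shows "ptrace n i (A + B) = ptrace n i A + ptrace n i B"
  using assms(1,2) ins_bit_props[OF assms(3)] by (auto simp: ptrace_def intro!: eq_matI)

lemma W1_bounded_zero: "W1_bounded n (0\<^sub>m (2 ^ n) (2 ^ n)) 0"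
  unfolding W1_bounded_def W1_decomposition_def
  by (intro exI[of _ "\<lambda>_. 0\<^sub>m (2 ^ n) (2 ^ n)"])
    (auto simp: obs0_zero ptrace_zero trace_norm_zero msum_def intro!: eq_matI)

lemma obs0_add: "obs0 n A \<Longrightarrow> obs0 n B \<Longrightarrow> obs0 n (A + B)"
  by (auto simp: obs0_def mtrace_add[of _ "2 ^ n"] intro!: hermitian_add[of _ "2 ^ n"])

lemma obs0_minus: "obs0 n A \<Longrightarrow> obs0 n B \<Longrightarrow> obs0 n (A - B)"
  by (auto simp: obs0_def mtrace_minus[of _ "2 ^ n"] intro!: hermitian_minus[of _ "2 ^ n"])

lemma W1_bounded_add:
  assumes "W1_bounded n A c" "W1_bounded n B d"
  shows "W1_bounded n (A + B) (c + d)"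
proof -
  obtain X where X: "W1_decomposition n A X" "(1/2) * (\<Sum>i<n. trace_norm (X i)) \<le> c"
    using assms(1) by (auto simp: W1_bounded_def)
  obtain Y where Y: "W1_decomposition n B Y" "(1/2) * (\<Sum>i<n. trace_norm (Y i)) \<le> d"
    using assms(2) by (auto simp: W1_bounded_def)
  have o: "obs0 n (X i)" "obs0 n (Y i)"
    and p: "ptrace n i (X i) = 0\<^sub>m (2^(n-1)) (2^(n-1))" "ptrace n i (Y i) = 0\<^sub>m (2^(n-1)) (2^(n-1))"
    if "i < n" for i
    using X(1) Y(1) that by (auto simp: W1_decomposition_def)
  have c: "X i \<in> carrier_mat (2 ^ n) (2 ^ n)" "Y i \<in> carrier_mat (2 ^ n) (2 ^ n)" if "i < n" for i
    using o[OF that] by (auto simp: obs0_def)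
  have "A + B = msum (2 ^ n) n X + msum (2 ^ n) n Y"
    using X(1) Y(1) by (auto simp: W1_decomposition_def)
  also have "\<dots> = msum (2 ^ n) n (\<lambda>i. X i + Y i)"
  proof (rule eq_matI)
    fix a b assume "a < dim_row (msum (2 ^ n) n (\<lambda>i. X i + Y i))" "b < dim_col (msum (2 ^ n) n (\<lambda>i. X i + Y i))"
    then have ab: "a < 2 ^ n" "b < 2 ^ n"
      by (auto simp: msum_def)
    have "(\<Sum>i<n. (X i + Y i) $$ (a, b)) = (\<Sum>i<n. X i $$ (a, b) + Y i $$ (a, b))"
      using ab c[THEN carrier_dims] by (intro sum.cong refl index_add_mat(1)) auto
    then show "(msum (2 ^ n) n X + msum (2 ^ n) n Y) $$ (a, b) = msum (2 ^ n) n (\<lambda>i. X i + Y i) $$ (a, b)"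
      using ab by (simp add: msum_def sum.distrib)
  qed (auto simp: msum_def)
  finally have "W1_decomposition n (A + B) (\<lambda>i. X i + Y i)"
    unfolding W1_decomposition_def using o p c by (auto simp: obs0_add ptrace_add)
  moreover have "(\<Sum>i<n. trace_norm (X i + Y i)) \<le> (\<Sum>i<n. trace_norm (X i)) + (\<Sum>i<n. trace_norm (Y i))"
    unfolding sum.distrib[symmetric]
    by (intro sum_mono trace_norm_triangle[of _ "2 ^ n"]) (use o in \<open>auto simp: obs0_def\<close>)
  then have "(1/2) * (\<Sum>i<n. trace_norm (X i + Y i)) \<le> c + d"
    using X(2) Y(2) by linarith
  ultimately show ?thesis
    unfolding W1_bounded_def by blast
qed

text \<open>The whole increment goes into slot i. Its trace norm is at most twice that of X, and the
  1/2 in the Wasserstein norm cancels the 2.\<close>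

lemma W1_bounded_minus_depol:
  assumes X: "obs0 n X" and i: "i < n"
  shows "W1_bounded n (X - depol n i X) (trace_norm X)"
proof -
  have Xc: "X \<in> carrier_mat (2 ^ n) (2 ^ n)" "hermitian X"
    using X by (auto simp: obs0_def)
  have D: "obs0 n (depol n i X)"
    using X Xc i hermitian_depol mtrace_depol by (auto simp: obs0_def)
  define Y where "Y j = (if j = i then X - depol n i X else 0\<^sub>m (2 ^ n) (2 ^ n))" for j
  have "X - depol n i X = msum (2 ^ n) n Y"
  proof (rule eq_matI)
    fix a b assume "a < dim_row (msum (2 ^ n) n Y)" "b < dim_col (msum (2 ^ n) n Y)"
    then have ab: "a < 2 ^ n" "b < 2 ^ n"
      by (auto simp: msum_def)
    have "(\<Sum>j<n. Y j $$ (a, b)) = (\<Sum>j<n. if j = i then (X - depol n i X) $$ (a, b) else 0)"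
      using ab by (intro sum.cong refl) (auto simp: Y_def)
    then show "(X - depol n i X) $$ (a, b) = msum (2 ^ n) n Y $$ (a, b)"
      using ab i by (simp add: msum_def)
  qed (use Xc in \<open>auto simp: msum_def\<close>)
  then have "W1_decomposition n (X - depol n i X) Y"
    unfolding W1_decomposition_def Y_def
    using obs0_minus[OF X D] ptrace_minus_depol[OF Xc(1) i] by (auto simp: obs0_zero ptrace_zero)
  moreover have "(\<Sum>j<n. trace_norm (Y j)) = (\<Sum>j<n. if j = i then trace_norm (X - depol n i X) else 0)"
    by (intro sum.cong refl) (auto simp: Y_def trace_norm_zero)
  then have "(1/2) * (\<Sum>j<n. trace_norm (Y j)) \<le> trace_norm X"
    using i trace_norm_triangle_minus[OF Xc depol_carrier hermitian_depol[OF Xc i]]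
      trace_norm_depol_le[OF Xc i] by simp
  ultimately show ?thesis
    unfolding W1_bounded_def by blast
qed

text \<open>Every increment is charged the norm of the operator reached so far, which never exceeds
  that of X because depolarising contracts the trace norm. Hence one copy of
  \<open>trace_norm X\<close> per qubit.\<close>

lemma W1_bounded_minus_fold_depol:
  assumes "obs0 n X" "set is \<subseteq> {..<n}"
  shows "W1_bounded n (X - fold (depol n) is X) (real (length is) * trace_norm X)"
  using assms
proof (induction "is" arbitrary: X)
  case Nil
  then have "X - X = 0\<^sub>m (2 ^ n) (2 ^ n)"
    by (auto simp: obs0_def)
  then show ?case
    using W1_bounded_zero by simp
next
  case (Cons i "is")
  have i: "i < n"
    using Cons.prems by simp
  have Xc: "X \<in> carrier_mat (2 ^ n) (2 ^ n)" "hermitian X"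
    using Cons.prems by (auto simp: obs0_def)
  have D: "obs0 n (depol n i X)"
    using Cons.prems Xc i hermitian_depol mtrace_depol by (auto simp: obs0_def)
  have "W1_bounded n ((X - depol n i X) + (depol n i X - fold (depol n) is (depol n i X)))
      (trace_norm X + real (length is) * trace_norm (depol n i X))"
    using Cons.prems by (intro W1_bounded_add W1_bounded_minus_depol Cons.IH D i) auto
  moreover have "(X - depol n i X) + (depol n i X - fold (depol n) is (depol n i X))
      = X - fold (depol n) (i # is) X"
    using Xc(1)[THEN carrier_dims] fold_depol_carrier[OF depol_carrier[of n i X], of "is", THEN carrier_dims]
    by (intro eq_matI) auto
  moreover have "trace_norm X + real (length is) * trace_norm (depol n i X)
      \<le> real (length (i # is)) * trace_norm X"
    using mult_left_mono[OF trace_norm_depol_le[OF Xc i], of "real (length is)"] by (simp add: algebra_simps)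
  ultimately show ?case
    using W1_bounded_mono by metis
qed

subsection \<open>Operators supported on a set of qubits\<close>

lemma bit_less_pow2: "bit (a::nat) j \<Longrightarrow> a < 2 ^ n \<Longrightarrow> j < n"
  by (metis bit_take_bit_iff take_bit_nat_eq_self_iff)

lemma less_pow2_eqI:
  assumes "a < (2::nat) ^ n" "b < 2 ^ n" "\<And>j. j < n \<Longrightarrow> bit a j = bit b j"
  shows "a = b"
  using assms bit_less_pow2 by (intro bit_eqI) blast

lemma nat_with_bits:
  obtains c :: nat where "c < 2 ^ n" "\<And>j. j < n \<Longrightarrow> bit c j = P j"
proof
  let ?c = "horner_sum of_bool 2 (map P [0..<n]) :: nat"
  show "bit ?c j = P j" if "j < n" for j
    using that by (simp add: bit_horner_sum_bit_iff)
  have "take_bit n ?c = ?c"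
    by (rule bit_eqI) (auto simp: bit_take_bit_iff bit_horner_sum_bit_iff)
  then show "?c < 2 ^ n"
    by (metis take_bit_nat_less_exp)
qed

text \<open>As a binary expansion, \<open>sub_index\<close> becomes accessible bit by bit: its bit m
  is the bit of a at the element of S in sorted position m, counted from 0.\<close>

lemma sub_index_horner_sum:
  "sub_index S a = horner_sum of_bool 2 (map (\<lambda>m. bit a (sorted_list_of_set S ! m)) [0..<card S])"
  unfolding sub_index_def horner_sum_eq_sum
  by (auto simp: qbit_def lessThan_atLeast0 bit_iff_odd mod_2_eq_odd intro!: sum.cong)

lemma bit_sub_index: "bit (sub_index S a) m \<longleftrightarrow> m < card S \<and> bit a (sorted_list_of_set S ! m)"
  by (auto simp: sub_index_horner_sum bit_horner_sum_bit_iff)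

lemma sub_index_less: "sub_index S a < 2 ^ card S"
proof -
  have "take_bit (card S) (sub_index S a) = sub_index S a"
    by (rule bit_eqI) (auto simp: bit_take_bit_iff bit_sub_index)
  then show ?thesis
    by (metis take_bit_nat_less_exp)
qed

lemma sub_index_eq_iff:
  assumes "finite S"
  shows "sub_index S a = sub_index S b \<longleftrightarrow> (\<forall>j\<in>S. bit a j = bit b j)"
proof
  assume eq: "sub_index S a = sub_index S b"
  show "\<forall>j\<in>S. bit a j = bit b j"
  proof
    fix j assume "j \<in> S"
    then obtain m where "m < card S" "sorted_list_of_set S ! m = j"
      using assms by (metis in_set_conv_nth set_sorted_list_of_set length_sorted_list_of_set)
    then show "bit a j = bit b j"
      using eq bit_sub_index by metis
  qed
next
  assume eq: "\<forall>j\<in>S. bit a j = bit b j"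
  have "sorted_list_of_set S ! m \<in> S" if "m < card S" for m
    using that assms by (metis nth_mem set_sorted_list_of_set length_sorted_list_of_set)
  then show "sub_index S a = sub_index S b"
    using eq by (intro bit_eqI) (auto simp: bit_sub_index)
qed

text \<open>In a product of embedded operators the middle index has to agree with a outside S. This
  bijection turns the sum over such indices into a sum over the basis of the register S.\<close>

lemma bij_betw_sub_index:
  assumes S: "S \<subseteq> {..<n}"
  shows "bij_betw (sub_index S) {c. c < 2 ^ n \<and> (\<forall>j<n. j \<notin> S \<longrightarrow> bit a j = bit c j)} {..<2 ^ card S}"
    (is "bij_betw _ ?C _")
proof (rule bij_betw_imageI)
  have fin: "finite S"
    using S finite_subset by blast
  show "inj_on (sub_index S) ?C"
  proof (rule inj_onI)
    fix c c' assume c: "c \<in> ?C" "c' \<in> ?C" and eq: "sub_index S c = sub_index S c'"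
    show "c = c'"
    proof (rule less_pow2_eqI[of _ n])
      fix j assume "j < n"
      then show "bit c j = bit c' j"
        using c eq sub_index_eq_iff[OF fin] by (cases "j \<in> S") auto
    qed (use c in auto)
  qed
  show "sub_index S ` ?C = {..<2 ^ card S}"
  proof (intro equalityI subsetI)
    fix x :: nat assume x: "x \<in> {..<2 ^ card S}"
    let ?l = "sorted_list_of_set S"
    have "\<forall>j\<in>S. \<exists>m<card S. ?l ! m = j"
      using fin by (metis in_set_conv_nth set_sorted_list_of_set length_sorted_list_of_set)
    then obtain idx where idx: "\<And>j. j \<in> S \<Longrightarrow> idx j < card S \<and> ?l ! idx j = j"
      by metis
    \<comment> \<open>The preimage of x carries the bits of x on S and those of a elsewhere.\<close>
    obtain c :: nat where c: "c < 2 ^ n" "\<And>j. j < n \<Longrightarrow> bit c j = (if j \<in> S then bit x (idx j) else bit a j)"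
      using nat_with_bits[of n "\<lambda>j. if j \<in> S then bit x (idx j) else bit a j"] by blast
    have "bit c (?l ! m) = bit x m" if m: "m < card S" for m
    proof -
      have lm: "?l ! m \<in> S"
        using m fin by (metis nth_mem set_sorted_list_of_set length_sorted_list_of_set)
      then have "idx (?l ! m) = m"
        using idx m fin by (metis nth_eq_iff_index_eq distinct_sorted_list_of_set length_sorted_list_of_set)
      then show ?thesis
        using c(2)[of "?l ! m"] lm S by auto
    qed
    then have "sub_index S c = x"
      using x by (intro less_pow2_eqI[OF sub_index_less]) (auto simp: bit_sub_index)
    moreover have "c \<in> ?C"
      using c by auto
    ultimately show "x \<in> sub_index S ` ?C"
      by blast
  qed (auto simp: sub_index_less)
qed

lemma embed_carrier [simp]: "embed n S h \<in> carrier_mat (2 ^ n) (2 ^ n)"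
  by (simp add: embed_def)

lemma embed_dim [simp]: "dim_row (embed n S h) = 2 ^ n" "dim_col (embed n S h) = 2 ^ n"
  by (simp_all add: embed_def)

lemma embed_index:
  "a < 2 ^ n \<Longrightarrow> b < 2 ^ n \<Longrightarrow> embed n S h $$ (a, b) =
    (if \<forall>j<n. j \<notin> S \<longrightarrow> bit a j = bit b j then h $$ (sub_index S a, sub_index S b) else 0)"
  by (simp add: embed_def qbit_eq_iff)

text \<open>Tensoring with the identity is multiplicative. With the lemmas on adjoints and diagonal
  matrices, this carries a diagonalisation of h over to the full space.\<close>

lemma embed_mult:
  assumes S: "S \<subseteq> {..<n}"
    and A: "A \<in> carrier_mat (2 ^ card S) (2 ^ card S)" and B: "B \<in> carrier_mat (2 ^ card S) (2 ^ card S)"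
  shows "embed n S (A * B) = embed n S A * embed n S B"
proof (rule eq_matI)
  fix a b assume "a < dim_row (embed n S A * embed n S B)" "b < dim_col (embed n S A * embed n S B)"
  then have ab: "a < 2 ^ n" "b < 2 ^ n"
    by auto
  let ?s = "sub_index S"
  let ?agree = "\<lambda>a b. \<forall>j<n. j \<notin> S \<longrightarrow> bit a j = bit b j"
  have prod: "(embed n S A * embed n S B) $$ (a, b) = (\<Sum>c<2^n. embed n S A $$ (a, c) * embed n S B $$ (c, b))"
    by (rule index_mult_mat_sum[OF embed_carrier embed_carrier ab])
  show "embed n S (A * B) $$ (a, b) = (embed n S A * embed n S B) $$ (a, b)"
  proof (cases "?agree a b")
    case True
    have "(embed n S A * embed n S B) $$ (a, b)
        = (\<Sum>c\<in>{c. c < 2 ^ n \<and> ?agree a c}. A $$ (?s a, ?s c) * B $$ (?s c, ?s b))"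
      unfolding prod using ab True
      by (intro sum.mono_neutral_cong_right) (auto simp: embed_index)
    also have "\<dots> = (\<Sum>x<2 ^ card S. A $$ (?s a, x) * B $$ (x, ?s b))"
      by (rule sum.reindex_bij_betw[OF bij_betw_sub_index[OF S]])
    also have "\<dots> = (A * B) $$ (?s a, ?s b)"
      by (rule index_mult_mat_sum[OF A B sub_index_less sub_index_less, symmetric])
    finally show ?thesis
      using True ab by (simp add: embed_index del: index_mult_mat(1))
  next
    case False
    then have "(embed n S A * embed n S B) $$ (a, b) = 0"
      unfolding prod using ab by (intro sum.neutral ballI) (auto simp: embed_index)
    then show ?thesis
      by (simp only: embed_index[OF ab] False if_False)
  qed
qed auto

lemma embed_adjoint:
  assumes "A \<in> carrier_mat (2 ^ card S) (2 ^ card S)"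
  shows "embed n S (mat_adjoint A) = mat_adjoint (embed n S A)"
proof (rule eq_matI)
  fix a b assume "a < dim_row (mat_adjoint (embed n S A))" "b < dim_col (mat_adjoint (embed n S A))"
  then show "embed n S (mat_adjoint A) $$ (a, b) = mat_adjoint (embed n S A) $$ (a, b)"
    using assms[THEN carrier_dims] sub_index_less[of S] by (auto simp: embed_index)
qed auto

lemma embed_mat_diag:
  assumes S: "S \<subseteq> {..<n}"
  shows "embed n S (mat_diag (2 ^ card S) f) = mat_diag (2 ^ n) (\<lambda>a. f (sub_index S a))"
proof (rule eq_matI)
  fix a b assume "a < dim_row (mat_diag (2 ^ n) (\<lambda>a. f (sub_index S a)))"
    "b < dim_col (mat_diag (2 ^ n) (\<lambda>a. f (sub_index S a)))"
  then have ab: "a < 2 ^ n" "b < 2 ^ n"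
    by auto
  have "a = b" if "\<forall>j<n. j \<notin> S \<longrightarrow> bit a j = bit b j" "sub_index S a = sub_index S b"
    using that ab sub_index_eq_iff[of S a b] finite_subset[OF S] by (intro less_pow2_eqI[of _ n]) auto
  then show "embed n S (mat_diag (2 ^ card S) f) $$ (a, b)
      = mat_diag (2 ^ n) (\<lambda>a. f (sub_index S a)) $$ (a, b)"
    using ab sub_index_less[of S] by (auto simp: embed_index mat_diag_def)
qed auto

lemma unitary_embed:
  assumes S: "S \<subseteq> {..<n}" and P: "unitary (2 ^ card S) P"
  shows "unitary (2 ^ n) (embed n S P)"
proof -
  note Pc = unitaryD(1)[OF P]
  \<comment> \<open>The identity is written as a constant diagonal matrix so that
    \<open>embed_mat_diag\<close> applies to it.\<close>
  have "mat_adjoint (embed n S P) * embed n S P = embed n S (mat_diag (2 ^ card S) (\<lambda>_. 1))"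
    using Pc unitaryD(2)[OF P] by (simp add: embed_adjoint[symmetric] embed_mult[OF S, symmetric])
  then show ?thesis
    by (simp add: unitary_def embed_mat_diag[OF S] del: mat_diag_one) simp
qed

text \<open>Invariance under one simultaneous flip, iterated over T: each induction step undoes one
  flip in a' and b'.\<close>

lemma trivial_on_flips:
  assumes "finite T" "\<And>i. i \<in> T \<Longrightarrow> i < n \<and> trivial_on n i M"
    "a < 2 ^ n" "b < 2 ^ n" "a' < 2 ^ n" "b' < 2 ^ n"
    "\<And>j. j < n \<Longrightarrow> bit a' j = (bit a j \<noteq> (j \<in> T))" "\<And>j. j < n \<Longrightarrow> bit b' j = (bit b j \<noteq> (j \<in> T))"
  shows "M $$ (a', b') = M $$ (a, b)"
  using assms
proof (induction T arbitrary: a' b')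
  case empty
  then have "a' = a" "b' = b"
    by (auto intro!: less_pow2_eqI[of _ n])
  then show ?case by simp
next
  case (insert i T)
  have i: "i < n" "trivial_on n i M"
    using insert.prems(1) by auto
  have "M $$ (flip_bit i a', flip_bit i b') = M $$ (a, b)"
    using insert.prems insert.hyps i flip_bit_less by (intro insert.IH) auto
  then show ?case
    using i(2) insert.prems(4,5) by (simp add: trivial_on_def)
qed

text \<open>The entry $(a,b)$ of either product has a single nonzero term; the two terms are related by
  flipping the qubits of $S$ on which $a$ and $b$ differ.\<close>

lemma trivial_on_commutes_embed:
  assumes S: "S \<subseteq> {..<n}" and M: "M \<in> carrier_mat (2 ^ n) (2 ^ n)"
    and tr: "\<And>i. i \<in> S \<Longrightarrow> trivial_on n i M"
  shows "M * embed n S h = embed n S h * M"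
proof (rule eq_matI)
  fix a b assume "a < dim_row (embed n S h * M)" "b < dim_col (embed n S h * M)"
  then have ab: "a < 2 ^ n" "b < 2 ^ n"
    using M by auto
  have fin: "finite S"
    using S finite_subset by blast
  \<comment> \<open>The only middle indices that survive: M forces agreement on S and the embedded
    operator forces agreement off S. So c joins a on S with b off S, and d does the
    opposite.\<close>
  obtain c :: nat where c: "c < 2 ^ n" "\<And>j. j < n \<Longrightarrow> bit c j = (if j \<in> S then bit a j else bit b j)"
    using nat_with_bits[of n "\<lambda>j. if j \<in> S then bit a j else bit b j"] by blast
  obtain d :: nat where d: "d < 2 ^ n" "\<And>j. j < n \<Longrightarrow> bit d j = (if j \<in> S then bit b j else bit a j)"
    using nat_with_bits[of n "\<lambda>j. if j \<in> S then bit b j else bit a j"] by blast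
  have M0: "M $$ (x, y) = 0" if "x < 2 ^ n" "y < 2 ^ n" "j \<in> S" "bit x j \<noteq> bit y j" for x y j
    using tr[OF that(3)] that by (auto simp: trivial_on_def)
  have "sub_index S c = sub_index S a" "sub_index S d = sub_index S b"
    using c(2) d(2) S by (auto simp: sub_index_eq_iff[OF fin])
  then have Ec: "embed n S h $$ (c, b) = h $$ (sub_index S a, sub_index S b)"
    and Ed: "embed n S h $$ (a, d) = h $$ (sub_index S a, sub_index S b)"
    using c d ab by (auto simp: embed_index)
  have z: "M $$ (a, x) * embed n S h $$ (x, b) = 0" if x: "x < 2 ^ n" "x \<noteq> c" for x
  proof (rule ccontr)
    assume "\<not> ?thesis"
    then have "M $$ (a, x) \<noteq> 0" "\<forall>j<n. j \<notin> S \<longrightarrow> bit x j = bit b j"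
      using x ab by (auto simp: embed_index split: if_splits)
    then have "x = c"
      using M0[OF ab(1) x(1)] c by (intro less_pow2_eqI[OF x(1) c(1)]) auto
    then show False
      using x by simp
  qed
  have "(\<Sum>x\<in>{..<2^n} - {c}. M $$ (a, x) * embed n S h $$ (x, b)) = 0"
    by (rule sum.neutral) (use z in blast)
  then have L: "(M * embed n S h) $$ (a, b) = M $$ (a, c) * h $$ (sub_index S a, sub_index S b)"
    unfolding index_mult_mat_sum[OF M embed_carrier ab] Ec[symmetric]
    using c(1) by (subst sum.remove[of _ c]) auto
  have z: "embed n S h $$ (a, x) * M $$ (x, b) = 0" if x: "x < 2 ^ n" "x \<noteq> d" for x
  proof (rule ccontr)
    assume "\<not> ?thesis"
    then have "M $$ (x, b) \<noteq> 0" "\<forall>j<n. j \<notin> S \<longrightarrow> bit a j = bit x j"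
      using x ab by (auto simp: embed_index split: if_splits)
    then have "x = d"
      using M0[OF x(1) ab(2)] d by (intro less_pow2_eqI[OF x(1) d(1)]) auto
    then show False
      using x by simp
  qed
  have "(\<Sum>x\<in>{..<2^n} - {d}. embed n S h $$ (a, x) * M $$ (x, b)) = 0"
    by (rule sum.neutral) (use z in blast)
  then have R: "(embed n S h * M) $$ (a, b) = h $$ (sub_index S a, sub_index S b) * M $$ (d, b)"
    unfolding index_mult_mat_sum[OF embed_carrier M ab] Ed[symmetric]
    using d(1) by (subst sum.remove[of _ d]) auto
  have "M $$ (d, b) = M $$ (a, c)"
    using tr S c d ab
    by (intro trivial_on_flips[of "{j \<in> S. bit a j \<noteq> bit b j}" n]) (auto intro: finite_subset[OF _ fin])
  then show "(M * embed n S h) $$ (a, b) = (embed n S h * M) $$ (a, b)"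
    unfolding L R by simp
qed (use M in auto)

subsection \<open>Gates\<close>

lemma unitary_diag_pow:
  assumes P: "unitary n P"
  shows "(P * mat_diag n d * mat_adjoint P) ^\<^sub>m k = P * mat_diag n (\<lambda>i. d i ^ k) * mat_adjoint P"
proof (induction k)
  case 0
  show ?case
    using unitaryD[OF P] by simp
next
  case (Suc k)
  then show ?case
    by (simp add: unitary_diag_mult[OF P] mult.commute)
qed

lemma unitary_diag_index:
  assumes P: "unitary n P" and ij: "i < n" "j < n"
  shows "(P * mat_diag n d * mat_adjoint P) $$ (i, j) = (\<Sum>l<n. P $$ (i, l) * d l * cnj (P $$ (j, l)))"
proof -
  note Pc = unitaryD(1)[OF P]
  have "P * mat_diag n d \<in> carrier_mat n n"
    using Pc by auto
  then show ?thesis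
    using Pc[THEN carrier_dims] ij
    by (simp add: index_mult_mat_sum[OF _ mat_adjoint_carrier[OF Pc] ij] mat_diag_mult_right[OF Pc]
        del: index_mult_mat(1))
qed

text \<open>In the eigenbasis each entry of a partial sum is a fixed finite combination of scalar
  exponential series. The entrywise limits therefore exist, as \<open>lim\<close> in
  \<open>mat_exp\<close> needs to have the intended value.\<close>

lemma mat_exp_unitary_diag:
  assumes P: "unitary n P"
  shows "mat_exp (P * mat_diag n d * mat_adjoint P) = P * mat_diag n (\<lambda>i. exp (d i)) * mat_adjoint P"
    (is "mat_exp ?A = ?B")
proof (rule eq_matI)
  note Pc = unitaryD(1)[OF P, THEN carrier_dims]
  fix i j assume "i < dim_row ?B" "j < dim_col ?B"
  then have ij: "i < n" "j < n"
    using Pc by auto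
  have partial: "(\<Sum>k<N. (?A ^\<^sub>m k) $$ (i, j) / of_nat (fact k))
      = (\<Sum>l<n. P $$ (i, l) * (\<Sum>k<N. d l ^ k / of_nat (fact k)) * cnj (P $$ (j, l)))" for N
    unfolding unitary_diag_pow[OF P] unitary_diag_index[OF P ij] sum_divide_distrib
    by (subst sum.swap) (simp add: sum_distrib_left sum_distrib_right)
  have "(\<lambda>N. \<Sum>k<N. d l ^ k / of_nat (fact k)) \<longlonglongrightarrow> exp (d l)" for l
    using exp_converges[of "d l"] by (simp add: sums_def scaleR_conv_of_real field_simps)
  then have "(\<lambda>N. \<Sum>k<N. (?A ^\<^sub>m k) $$ (i, j) / of_nat (fact k))
      \<longlonglongrightarrow> (\<Sum>l<n. P $$ (i, l) * exp (d l) * cnj (P $$ (j, l)))"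
    unfolding partial by (intro tendsto_sum tendsto_mult tendsto_const)
  then show "mat_exp ?A $$ (i, j) = ?B $$ (i, j)"
    unfolding mat_exp_def unitary_diag_index[OF P ij] using ij Pc by (simp add: limI)
qed (use unitaryD(1)[OF P, THEN carrier_dims] in \<open>auto simp: mat_exp_def\<close>)

lemma smult_smult_mat: "a \<cdot>\<^sub>m (b \<cdot>\<^sub>m A) = (a * b) \<cdot>\<^sub>m (A :: complex mat)"
  by (intro eq_matI) auto

lemma smult_unitary_diag:
  assumes P: "unitary n P"
  shows "c \<cdot>\<^sub>m (P * mat_diag n d * mat_adjoint P) = P * mat_diag n (\<lambda>i. c * d i) * mat_adjoint P"
  using unitaryD(1)[OF P, THEN carrier_dims]
  by (intro eq_matI)
    (auto simp: unitary_diag_index[OF P] sum_distrib_left mult_ac simp del: index_mult_mat(1) intro!: sum.cong)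

text \<open>With $R = 1 - W$ one has $X - W X W^\dagger = R X + W X R^\dagger$.\<close>

lemma trace_norm_minus_conj_le:
  assumes X: "X \<in> carrier_mat n n" "hermitian X" and Q: "unitary n Q"
    and w: "\<And>k. k < n \<Longrightarrow> cmod (w k) = 1" "\<And>k. k < n \<Longrightarrow> cmod (1 - w k) \<le> c"
    and W_def: "W = Q * mat_diag n w * mat_adjoint Q"
  shows "trace_norm (X - W * X * mat_adjoint W) \<le> 2 * c * trace_norm X"
proof (rule trace_norm_leI)
  note Qc = unitaryD(1)[OF Q]
  have W: "unitary n W"
    unfolding W_def by (intro unitary_mult unitary_adjoint Q unitary_mat_diag w(1))
  note Wc = unitaryD(1)[OF W]
  \<comment> \<open>R shares the eigenvectors of W, so its norm is governed by the eigenvalues 1 - w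
    k.\<close>
  define R where "R = Q * mat_diag n (\<lambda>k. 1 - w k) * mat_adjoint Q"
  have Rc: "R \<in> carrier_mat n n"
    using Qc by (auto simp: R_def)
  have "Q * mat_diag n (\<lambda>_. 1) * mat_adjoint Q = 1\<^sub>m n"
    using unitaryD[OF Q] by simp
  then have R: "R $$ (i, j) = 1\<^sub>m n $$ (i, j) - W $$ (i, j)" if "i < n" "j < n" for i j
    unfolding R_def W_def using unitary_diag_index[OF Q that] 
    by (simp add: algebra_simps sum_subtractf flip: \<open>_ = 1\<^sub>m n\<close> del: index_mult_mat(1) mat_diag_one)
  have R: "R = 1\<^sub>m n - W"
    using R Rc Wc by (intro eq_matI) auto
  let ?D = "X - W * X * mat_adjoint W"
  have WXW: "W * X * mat_adjoint W \<in> carrier_mat n n"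
    using Wc X by auto
  show "?D \<in> carrier_mat n n"
    using WXW by (rule minus_carrier_mat)
  show "hermitian ?D"
    using X WXW hermitian_conj[OF X Wc] hermitian_minus by blast
  fix V assume V: "unitary n V"
  note Vc = unitaryD(1)[OF V]
  note dims = Qc[THEN carrier_dims] Wc[THEN carrier_dims] Vc[THEN carrier_dims] X(1)[THEN carrier_dims]
  have RX: "R * X = X - W * X"
    unfolding R using Wc X by (simp add: minus_mult_distrib_mat[of _ n n])
  have XR: "W * X * mat_adjoint R = W * X - W * X * mat_adjoint W"
    unfolding R using Wc X
    by (simp add: mat_adjoint_minus[of _ n n] mult_minus_distrib_mat[of _ n n _ n] mult_carrier_mat[of _ n n _ n]
        right_mult_one_mat[of _ n n])
  have "?D = R * X + W * X * mat_adjoint R"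
    unfolding RX XR using dims by (intro eq_matI) (auto simp del: index_mult_mat(1))
  then have "V * ?D = V * (R * X) + V * (W * X * mat_adjoint R)"
    using Vc Rc Wc X by (simp add: mult_add_distrib_mat[of _ n n _ n] mult_carrier_mat[of _ n n _ n])
  then have "mtrace (V * ?D) = mtrace (V * (R * X)) + mtrace (V * (W * X * mat_adjoint R))"
    using Vc Rc Wc X by (simp add: mtrace_add[of _ n] mult_carrier_mat[of _ n n _ n])
  \<comment> \<open>Rotating brings X to the right end, with the diagonal factor of the adjoint of R
    between unitaries. Both terms then have the shape of \<open>trace_norm_duality\<close>, and each
    contributes c.\<close>
  also have "mtrace (V * (W * X * mat_adjoint R)) = mtrace (mat_adjoint R * V * (W * X))"
    using Vc Rc Wc X by (intro mtrace_rotate) auto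
  also have "mat_adjoint R * V * (W * X)
      = Q * mat_diag n (\<lambda>k. cnj (1 - w k)) * (mat_adjoint Q * V * W) * X"
    unfolding R_def unitary_diag_adjoint[OF Q] using dims by (simp add: mult_assoc_dim)
  also have "V * (R * X) = V * Q * mat_diag n (\<lambda>k. 1 - w k) * mat_adjoint Q * X"
    unfolding R_def using dims by (simp add: mult_assoc_dim)
  finally have "cmod (mtrace (V * ?D))
      \<le> cmod (mtrace (V * Q * mat_diag n (\<lambda>k. 1 - w k) * mat_adjoint Q * X))
        + cmod (mtrace (Q * mat_diag n (\<lambda>k. cnj (1 - w k)) * (mat_adjoint Q * V * W) * X))"
    by (simp add: norm_triangle_ineq)
  also have "\<dots> \<le> c * trace_norm X + c * trace_norm X"
    using w(2) by (intro add_mono trace_norm_duality X unitary_mult unitary_adjoint V Q W)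
      (auto simp del: complex_cnj_diff)
  finally show "cmod (mtrace (V * ?D)) \<le> 2 * c * trace_norm X"
    by simp
qed

lemma eigenvalues_unitary_diag:
  assumes P: "unitary n P"
  shows "{x. eigenvalue (P * mat_diag n f * mat_adjoint P) x} = f ` {..<n}"
proof -
  have c: "P * mat_diag n f * mat_adjoint P \<in> carrier_mat n n"
    using unitaryD(1)[OF P] by auto
  show ?thesis
    unfolding eigenvalue_root_char_poly[OF c] char_poly_unitary_diag[OF P]
    by (auto simp: poly_prod_list prod_list_zero_iff)
qed

text \<open>The centre c is the midpoint of the spectrum, from which all eigenvalues are within half
  its width. It later becomes the global phase.\<close>

lemma
  assumes P: "unitary n P" and h: "h = P * mat_diag n (\<lambda>i. complex_of_real (d i)) * mat_adjoint P"
    and n: "0 < n"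
  shows spread_nonneg: "0 \<le> spread h"
    and spread_bound: "\<exists>c. \<forall>i<n. \<bar>d i - c\<bar> \<le> spread h"
proof -
  have "Re ` {x. eigenvalue h x} = d ` {..<n}"
    unfolding h eigenvalues_unitary_diag[OF P] by (simp add: image_image)
  then have s: "spread h = (Max (d ` {..<n}) - Min (d ` {..<n})) / 2"
    by (simp add: spread_def)
  have le: "d i \<le> Max (d ` {..<n})" "Min (d ` {..<n}) \<le> d i" if "i < n" for i
    using that by auto
  show "\<exists>c. \<forall>i<n. \<bar>d i - c\<bar> \<le> spread h"
  proof (intro exI allI impI)
    fix i assume i: "i < n"
    show "\<bar>d i - (Max (d ` {..<n}) + Min (d ` {..<n})) / 2\<bar> \<le> spread h"
      using le[OF i] unfolding s abs_le_iff add_divide_distrib diff_divide_distrib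
      by (intro conjI; linarith)
  qed
  show "0 \<le> spread h"
    using le[OF n] by (simp add: s)
qed

text \<open>A chord of the unit circle is no longer than its arc.\<close>

lemma cmod_one_minus_exp_le: "cmod (1 - exp (\<i> * complex_of_real t)) \<le> \<bar>t\<bar>"
proof -
  have "cmod (1 - exp (\<i> * complex_of_real t)) = 2 * \<bar>sin (t / 2)\<bar>"
    using dist_exp_i_1[of t] by (simp add: norm_minus_commute)
  also have "\<dots> \<le> \<bar>t\<bar>"
    using abs_sin_x_le_abs_x[of "t / 2"] by simp
  finally show ?thesis .
qed

text \<open>The four facts are proved together because they share one diagonalisation of h.\<close>

lemma gate_properties:
  assumes S: "S \<subseteq> {..<n}" and hc: "h \<in> carrier_mat (2 ^ card S) (2 ^ card S)" and hh: "hermitian h"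
    and T: "0 \<le> T" and U_def: "U = mat_exp ((- \<i> * complex_of_real T) \<cdot>\<^sub>m embed n S h)"
  shows unitary_gate: "unitary (2 ^ n) U"
    and spread_gate_nonneg: "0 \<le> spread h"
    and gate_commutes: "\<lbrakk>M \<in> carrier_mat (2 ^ n) (2 ^ n); \<And>i. i \<in> S \<Longrightarrow> trivial_on n i M\<rbrakk> \<Longrightarrow> M * U = U * M"
    and trace_norm_gate: "\<lbrakk>X \<in> carrier_mat (2 ^ n) (2 ^ n); hermitian X\<rbrakk>
      \<Longrightarrow> trace_norm (X - U * X * mat_adjoint U) \<le> 2 * (spread h * T) * trace_norm X"
proof -
  let ?N = "2 ^ n :: nat" and ?K = "2 ^ card S :: nat"
  obtain P d where P: "unitary ?K P"
    and hd: "h = P * mat_diag ?K (\<lambda>i. complex_of_real (d i)) * mat_adjoint P"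
    using hermitian_spectral[OF hc hh] .
  note Pc = unitaryD(1)[OF P]
  define Q where "Q = embed n S P"
  have Q: "unitary ?N Q"
    unfolding Q_def by (rule unitary_embed[OF S P])
  note Qc = unitaryD(1)[OF Q]
  \<comment> \<open>All functions of h become diagonal in the same embedded basis Q, with values
    looked up through \<open>sub_index\<close>.\<close>
  have emb: "embed n S (P * mat_diag ?K f * mat_adjoint P)
      = Q * mat_diag ?N (\<lambda>a. f (sub_index S a)) * mat_adjoint Q" for f
    using Pc by (simp add: Q_def embed_mult[OF S] embed_adjoint embed_mat_diag[OF S]
        mult_carrier_mat[of _ ?K ?K _ ?K])
  define u where "u x = exp (- \<i> * complex_of_real T * complex_of_real (d x))" for x
  have U: "U = Q * mat_diag ?N (\<lambda>a. u (sub_index S a)) * mat_adjoint Q"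
    unfolding U_def hd emb smult_unitary_diag[OF Q] mat_exp_unitary_diag[OF Q] u_def ..
  have u1: "cmod (u x) = 1" for x
    by (simp add: u_def)
  show "unitary ?N U"
    unfolding U by (intro unitary_mult unitary_adjoint Q unitary_mat_diag u1)
  show "0 \<le> spread h"
    by (rule spread_nonneg[OF P hd]) simp
  \<comment> \<open>Read from right to left, \<open>emb\<close> exhibits U itself as an embedded
    operator on S.\<close>
  show "M * U = U * M" if "M \<in> carrier_mat ?N ?N" "\<And>i. i \<in> S \<Longrightarrow> trivial_on n i M" for M
    unfolding U emb[symmetric] by (rule trivial_on_commutes_embed[OF S that])
  obtain c where c: "\<And>i. i < ?K \<Longrightarrow> \<bar>d i - c\<bar> \<le> spread h"
    using spread_bound[OF P hd] by auto
  \<comment> \<open>This phase centres the spectrum: the exponents become T (c - d), of modulus at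
    most \<open>spread h * T\<close>. Conjugation by W = ph U agrees with conjugation by U because
    the phase cancels.\<close>
  define ph where "ph = exp (\<i> * complex_of_real (T * c))"
  have ph: "ph * cnj ph = 1"
    by (simp add: ph_def complex_norm_square[symmetric] del: of_real_power)
  define w where "w a = ph * u (sub_index S a)" for a
  define W where "W = Q * mat_diag ?N w * mat_adjoint Q"
  have W: "W = ph \<cdot>\<^sub>m U"
    unfolding U smult_unitary_diag[OF Q] W_def w_def ..
  have w: "w a = exp (\<i> * complex_of_real (T * (c - d (sub_index S a))))" for a
    by (simp add: w_def ph_def u_def algebra_simps flip: exp_add)
  show "trace_norm (X - U * X * mat_adjoint U) \<le> 2 * (spread h * T) * trace_norm X"
    if X: "X \<in> carrier_mat ?N ?N" "hermitian X" for X
  proof -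
    have Uc: "U \<in> carrier_mat ?N ?N"
      using Qc by (auto simp: U)
    have "mat_adjoint W = cnj ph \<cdot>\<^sub>m mat_adjoint U"
      unfolding W using Uc by (intro eq_matI) auto
    then have "W * X * mat_adjoint W = (ph * cnj ph) \<cdot>\<^sub>m (U * X * mat_adjoint U)"
      unfolding W using Uc X
      by (simp add: mult_smult_assoc_mat[of _ ?N ?N _ ?N] mult_smult_distrib[of _ ?N ?N _ ?N]
          mult_carrier_mat[of _ ?N ?N _ ?N] smult_smult_mat mult.commute)
    then have "W * X * mat_adjoint W = U * X * mat_adjoint U"
      unfolding ph by (intro eq_matI) auto
    moreover have "cmod (1 - w a) \<le> spread h * T" for a
    proof -
      have "cmod (1 - w a) \<le> \<bar>T * (c - d (sub_index S a))\<bar>"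
        unfolding w by (rule cmod_one_minus_exp_le)
      also have "\<dots> = \<bar>d (sub_index S a) - c\<bar> * T"
        using T by (simp add: abs_mult abs_minus_commute)
      also have "\<dots> \<le> spread h * T"
        using T c[OF sub_index_less] by (intro mult_right_mono) auto
      finally show ?thesis .
    qed
    moreover have "cmod (w a) = 1" for a
      unfolding w by simp
    ultimately show ?thesis
      using trace_norm_minus_conj_le[OF X Q _ _ W_def, of "spread h * T"] by simp
  qed
qed

lemma W1_bounded_gate:
  assumes S: "S \<subseteq> {..<n}" and h: "h \<in> carrier_mat (2 ^ card S) (2 ^ card S)" "hermitian h"
    and T: "0 \<le> T" and U: "U = mat_exp ((- \<i> * complex_of_real T) \<cdot>\<^sub>m embed n S h)"
    and X: "X \<in> carrier_mat (2 ^ n) (2 ^ n)" "hermitian X"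
  shows "W1_bounded n (X - U * X * mat_adjoint U) (2 * (real (card S) * spread h * T) * trace_norm X)"
proof -
  let ?is = "sorted_list_of_set S" and ?D = "X - U * X * mat_adjoint U"
  have fin: "finite S"
    using S finite_subset by blast
  have Uu: "unitary (2 ^ n) U"
    by (rule unitary_gate[OF S h T U])
  note Uc = unitaryD(1)[OF Uu]
  have UXU: "U * X * mat_adjoint U \<in> carrier_mat (2 ^ n) (2 ^ n)"
    using Uc X by auto
  have obs: "obs0 n ?D"
    using X UXU minus_carrier_mat[OF UXU] hermitian_conj[OF X Uc] hermitian_minus mtrace_minus[OF X(1) UXU] mtrace_unitary_conj[OF Uu X(1)]
    by (auto simp: obs0_def)
  \<comment> \<open>Listing S in sorted order visits each qubit once, so the number of channels is
    \<open>card S\<close>.\<close>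
  have "fold (depol n) ?is ?D = 0\<^sub>m (2 ^ n) (2 ^ n)"
    using gate_commutes[OF S h T U] Uu X(1) S fin by (intro fold_depol_minus_conj) auto
  moreover have "?D - 0\<^sub>m (2 ^ n) (2 ^ n) = ?D"
    using obs by (intro eq_matI) (auto simp: obs0_def)
  ultimately have "W1_bounded n ?D (real (card S) * trace_norm ?D)"
    using W1_bounded_minus_fold_depol[OF obs, of ?is] S fin by simp
  moreover have "real (card S) * trace_norm ?D \<le> real (card S) * (2 * (spread h * T) * trace_norm X)"
    by (intro mult_left_mono trace_norm_gate[OF S h T U X]) simp
  ultimately have "W1_bounded n ?D (real (card S) * (2 * (spread h * T) * trace_norm X))"
    by (rule W1_bounded_mono)
  then show ?thesis
    by (simp add: mult_ac)
qed

subsection \<open>Circuits\<close>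

text \<open>The pure state with all qubits 0. It shows that the set under \<open>Sup\<close> in
  \<open>C_W1\<close> is nonempty, as \<open>cSup_least\<close> requires.\<close>

lemma density_exists: "\<exists>\<rho>. density n \<rho>"
proof
  let ?N = "2 ^ n :: nat"
  let ?\<rho> = "mat_diag ?N (\<lambda>i. if i = 0 then 1 else 0 :: complex)"
  have "psd ?\<rho>"
    unfolding psd_def
  proof
    fix v :: "complex vec" assume v: "v \<in> carrier_vec (dim_col ?\<rho>)"
    have row: "(?\<rho> *\<^sub>v v) $ i = (if i = 0 then v $ 0 else 0)" if "i < ?N" for i
    proof -
      have "(?\<rho> *\<^sub>v v) $ i = (\<Sum>j\<in>{0..<?N}. ?\<rho> $$ (i, j) * v $ j)"
        using that v by (simp add: scalar_prod_def)
      also have "\<dots> = (\<Sum>j\<in>{0..<?N}. if j = 0 then if i = 0 then v $ 0 else 0 else 0)"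
        using that by (intro sum.cong refl) (auto simp: mat_diag_def)
      finally show ?thesis
        by simp
    qed
    have "(?\<rho> *\<^sub>v v) \<bullet>c v = (\<Sum>i\<in>{0..<?N}. (?\<rho> *\<^sub>v v) $ i * cnj (v $ i))"
      using v by (simp add: scalar_prod_def[of _ "conjugate v"] del: index_mult_mat_vec)
    also have "\<dots> = (\<Sum>i\<in>{0..<?N}. if i = 0 then v $ 0 * cnj (v $ 0) else 0)"
      using row by (intro sum.cong refl) (auto simp del: index_mult_mat_vec)
    also have "\<dots> = complex_of_real ((cmod (v $ 0))\<^sup>2)"
      by (simp add: complex_norm_square del: of_real_power)
    finally show "(?\<rho> *\<^sub>v v) \<bullet>c v \<in> \<real> \<and> 0 \<le> Re ((?\<rho> *\<^sub>v v) \<bullet>c v)"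
      by (simp del: of_real_power)
  qed
  moreover have "hermitian ?\<rho>"
    by (simp add: hermitian_def mat_adjoint_mat_diag if_distrib cong: if_cong)
  moreover have "mtrace ?\<rho> = 1"
    by (simp add: mtrace_def mat_diag_def)
  ultimately show "density n ?\<rho>"
    by (simp add: density_def)
qed

lemma W1_bounded_circuit:
  assumes supp: "\<And>l. l < L \<Longrightarrow> S l \<subseteq> {..<n}"
    and loc: "\<And>l. l < L \<Longrightarrow> h l \<in> carrier_mat (2 ^ card (S l)) (2 ^ card (S l)) \<and> hermitian (h l)"
    and Tnn: "\<And>l. l < L \<Longrightarrow> 0 \<le> T l"
    and G: "\<And>l. l < L \<Longrightarrow> G l = mat_exp ((- \<i> * complex_of_real (T l)) \<cdot>\<^sub>m embed n (S l) (h l))"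
    and \<rho>: "density n \<rho>"
  shows "unitary (2 ^ n) (circuit n G L) \<and> W1_bounded n (\<rho> - circuit n G L * \<rho> * mat_adjoint (circuit n G L))
    (2 * (\<Sum>l<L. real (card (S l)) * spread (h l) * T l))"
proof -
  let ?c = "carrier_mat (2 ^ n) (2 ^ n)"
  have rc: "\<rho> \<in> ?c" and rh: "hermitian \<rho>"
    using \<rho> by (auto simp: density_def)
  show ?thesis
    using assms(1-4)
  proof (induction L)
    case 0
    have "\<rho> - 1\<^sub>m (2 ^ n) * \<rho> * mat_adjoint (1\<^sub>m (2 ^ n)) = 0\<^sub>m (2 ^ n) (2 ^ n)"
      using rc by simp
    then show ?case
      using W1_bounded_zero[of n] by (simp add: circuit_def unitary_one)
  next
    case (Suc L)
    define U where "U = circuit n G L"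
    have IH: "unitary (2 ^ n) U" "W1_bounded n (\<rho> - U * \<rho> * mat_adjoint U)
        (2 * (\<Sum>l<L. real (card (S l)) * spread (h l) * T l))"
      using Suc unfolding U_def by auto
    note Uc = unitaryD(1)[OF IH(1)]
    have S: "S L \<subseteq> {..<n}" and h: "h L \<in> carrier_mat (2 ^ card (S L)) (2 ^ card (S L))" "hermitian (h L)"
      and T: "0 \<le> T L" and GL: "G L = mat_exp ((- \<i> * complex_of_real (T L)) \<cdot>\<^sub>m embed n (S L) (h L))"
      using Suc.prems by auto
    have Gu: "unitary (2 ^ n) (G L)"
      by (rule unitary_gate[OF S h T GL])
    note Gc = unitaryD(1)[OF Gu]
    define \<sigma> where "\<sigma> = U * \<rho> * mat_adjoint U"
    have \<sigma>: "\<sigma> \<in> ?c" "hermitian \<sigma>"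
      using Uc rc hermitian_conj[OF rc rh Uc] by (auto simp: \<sigma>_def)
    have \<sigma>1: "trace_norm \<sigma> \<le> 1"
      using trace_norm_unitary_conj_le[OF rc rh IH(1)] trace_norm_density[OF \<rho>] by (simp add: \<sigma>_def)
    \<comment> \<open>Dropping that factor multiplies an inequality by the gate cost, hence the need
      for its sign.\<close>
    have nonneg: "0 \<le> 2 * (real (card (S L)) * spread (h L) * T L)"
      using spread_gate_nonneg[OF S h T GL] T by simp
    have "2 * (real (card (S L)) * spread (h L) * T L) * trace_norm \<sigma>
        \<le> 2 * (real (card (S L)) * spread (h L) * T L)"
      using mult_left_mono[OF \<sigma>1 nonneg] by (simp only: mult_1_right)
    then have "W1_bounded n (\<sigma> - G L * \<sigma> * mat_adjoint (G L)) (2 * (real (card (S L)) * spread (h L) * T L))"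
      using W1_bounded_mono[OF W1_bounded_gate[OF S h T GL \<sigma>]] by blast
    from W1_bounded_add[OF IH(2)[folded \<sigma>_def] this]
    have "W1_bounded n ((\<rho> - \<sigma>) + (\<sigma> - G L * \<sigma> * mat_adjoint (G L)))
        (2 * (\<Sum>l<Suc L. real (card (S l)) * spread (h l) * T l))"
      by (simp add: algebra_simps)
    moreover have "(\<rho> - \<sigma>) + (\<sigma> - G L * \<sigma> * mat_adjoint (G L)) = \<rho> - G L * \<sigma> * mat_adjoint (G L)"
      using rc[THEN carrier_dims] \<sigma>(1)[THEN carrier_dims] Gc[THEN carrier_dims]
      by (intro eq_matI) (auto simp del: index_mult_mat(1))
    moreover have "G L * \<sigma> * mat_adjoint (G L) = (G L * U) * \<rho> * mat_adjoint (G L * U)"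
      using rc[THEN carrier_dims] Uc[THEN carrier_dims] Gc[THEN carrier_dims]
      by (simp add: \<sigma>_def mult_assoc_dim mat_adjoint_mult_dim)
    moreover have "circuit n G (Suc L) = G L * U"
      by (simp add: circuit_def U_def)
    ultimately show ?case
      using unitary_mult[OF Gu IH(1)] by simp
  qed
qed

theorem theorem3:
  fixes n L :: nat and S :: "nat \<Rightarrow> nat set" and h H :: "nat \<Rightarrow> complex mat"
    and T :: "nat \<Rightarrow> real"
  assumes supp: "\<And>l. l < L \<Longrightarrow> S l \<subseteq> {..<n}"
    and loc: "\<And>l. l < L \<Longrightarrow> h l \<in> carrier_mat (2 ^ card (S l)) (2 ^ card (S l)) \<and> hermitian (h l)"
    and Hdef: "\<And>l. l < L \<Longrightarrow> H l = embed n (S l) (h l)"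
    and Tnn: "\<And>l. l < L \<Longrightarrow> 0 \<le> T l"
  shows "(\<Sum>l<L. real (card (S l)) * spread (h l) * T l)
           \<ge> (1/2) * C_W1 n (circuit n (\<lambda>l. mat_exp ((- \<i> * complex_of_real (T l)) \<cdot>\<^sub>m H l)) L)"
proof -
  let ?U = "circuit n (\<lambda>l. mat_exp ((- \<i> * complex_of_real (T l)) \<cdot>\<^sub>m H l)) L"
  let ?R = "\<Sum>l<L. real (card (S l)) * spread (h l) * T l"
  have "W1_norm n (\<rho> - ?U * \<rho> * mat_adjoint ?U) \<le> 2 * ?R" if "density n \<rho>" for \<rho>
    using W1_bounded_circuit[OF supp loc Tnn _ that] Hdef by (intro W1_norm_le) simp
  \<comment> \<open>The bound on the norm does not depend on the state, so it passes to the
    supremum; halving gives the claim.\<close>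
  then have "C_W1 n ?U \<le> 2 * ?R"
    unfolding C_W1_def using density_exists[of n] by (intro cSup_least) auto
  then show ?thesis
    by simp
qed

end
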